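(* Consider an instance of UPR with integral data and minimum makespan $T^*$, let $T\in\mathbb{N}$ with $T\ge T^*$, and let $\alpha\ge 0$. The algorithm UPR-DDD$(D,\mathcal{K},T,\alpha)$ described below terminates within at most $|N|T^*$ iterations and returns a solution whose makespan is at most $(1+\alpha)T^*$.
   Context: UPR: a directed graph $D=(N,A)$; each arc $vw\in A$ has transit time $\tau_{vw}\in\mathbb{N}$ and capacity $u_{vw}\in\mathbb{N}$; each node $v$ has storage capacity $b_v\in\mathbb{N}$; $\mathcal{K}$ is a finite set of packets with origin $s_k$ and destination $t_k$; $\mathcal{K}_v=\{k:s_k\ne v,t_k\ne v\}$. Each packet is routed along a single trajectory over discrete times (at each integer time it waits at a node or departs along an arc $vw$, arriving $\tau_{vw}$ later); at most $u_{vw}$ packets may depart along $vw$ simultaneously and at most $b_v$ active packets may be held at $v$ at any time. The makespan is the latest arrival time of a packet at its destination; $T^*$ is the minimum makespan. Time-expanded networks: for $T'\in\mathbb{N}$, $N_{T'}=\{(v,t):v\in N,0\le t\le T'\}$, movement arcs $A_{T'}=\{((v,t),(w,t+\tau_{vw})):vw\in A,t+\tau_{vw}\le T'\}$, holdover arcs $H_{T'}=\{((v,t),(v,t+1)):t<T'\}$. For $N_S\subseteq N_T$: $\mathtt{n_S}(v,t)=\min\{t'>t:(v,t')\in N_S\}$, $\mathtt{m_S}(v,t)=\mathtt{n_S}(v,t)-t$. Construction of $D_S$ from $N_S$: for each $(v,t)\in N_S$ with $t<T$ add holdover arc $e=((v,t),(v,\mathtt{n_S}(v,t)))$; for each $(v,t)\in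 N_S$ and $vw\in A$ add movement arc $f=((v,t),(w,t'))$ with $t'$ the largest value with $(w,t')\in N_S$, $t'\le t+\tau_{vw}$, capacity $u'_f=u_{vw}\mathtt{m_S}(v,t)$. With $N^-_S(v,t)$, $N^-_T(v,t)$ the tails of movement arcs entering $(v,t)$ in $D_S$, resp. $A_T$, and $U_e=\sum_{(w,t')\in N^-_T(v,t)\cup N^-_S(v,t)}u_{wv}(\mathtt{m_S}(w,t')-1)$, set $b'_e=b_v+U_e$ if $(v,t+1)\in N_S$ and $b'_e=2b_v+U_e$ otherwise. $\mathrm{UPR}(D_S)$: binary $x^k_e$ on arcs of $D_S$, minimize $\bar T$ s.t. $(t+\tau_{vw})x^k_e\le\bar T$ for movement arcs $e=((v,t),(w,t'))$; $\sum_{e=((v,t),(w,t'))\text{ movement},w=t_k}(t+\tau_{vw})x^k_e\le\bar T$ for each $k$; flow conservation in $D_S$ from $(s_k,0)$ to $(t_k,T)$; $\sum_k x^k_e\le u'_e$ on movement arcs; $\sum_{k\in\mathcal{K}_v}x^k_e\le b'_e$ on holdover arcs at $v$. Upper-bound step Compute-UB$(\hat x,\hat T,\alpha,\mathtt{UB})$: set $T'=\lceil(1+\alpha)\hat T\rceil$; let $P_k$ be the path in $D$ underlying packet $k$'s trajectory in $\hat x$; solve the fixed-path problem UPR-FP: minimize $\bar T$ over binary $x^k_e$ on $D_{T'}$ restricted, for packet $k$, to movement arcs that are copies of arcs of $P_k$ and holdover arcs at nodes of $P_k$, subject to $t'x^k_e\le\bar T$ on movement arcs $e=((v,t),(w,t'))$,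 $\sum_{e\text{ entering }t_k}t'x^k_e\le\bar T$, flow conservation from $(s_k,0)$ to $(t_k,T')$, original arc capacities $u_{vw}$ and storage capacities $b_v$ (counting packets in $\mathcal{K}_v$). If feasible with optimum $\bar T'$ and optimal solution $\bar x$, set $\mathtt{UB}=\min\{\mathtt{UB},\bar T'\}$ and return $(\mathtt{UB},\bar x)$; otherwise return $(\mathtt{UB},\emptyset)$. Augmentation step: for every arc $e=((v,t),(w,t'))$ of $D_S$ with $\hat x_e>0$ ($\hat x_e=\sum_k\hat x^k_e$ on movement arcs, $\sum_{k\in\mathcal{K}_v}\hat x^k_e$ on holdover arcs): if movement arc with $t'<t+\tau_{vw}$, add $(w,t+\tau_{vw})$ to $N_S$; if movement arc with $\hat x_e>u_{vw}$, add $(v,t+1)$; if holdover arc with $\hat x_e>b_v$, add $(z,\bar t+1)$ for every $(z,\bar t)\in N^-_T(v,t)$ with $\mathtt{m_S}(z,\bar t)>1$, and add $(v,t+1)$. Algorithm UPR-DDD$(D,\mathcal{K},T,\alpha)$: start with $N_S=\{(v,0),(v,T):v\in N\}$, $\mathtt{UB}=T$, $\mathtt{LB}=0$. Each iteration: construct $D_S$ from $N_S$; solve $\mathrm{UPR}(D_S)$ obtaining an optimal $\hat x$ with value $\hat T$; set $\mathtt{LB}=\max\{\mathtt{LB},\hat T\}$; run Compute-UB$(\hat x,\hat T,\alpha,\mathtt{UB})$ obtaining $(\mathtt{UB},\bar x)$; set $\mathrm{gap}=(\mathtt{UB}-\mathtt{LB})/\mathtt{UB}$; if $\mathrm{gap}\le\alpha$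 and $\bar x\ne\emptyset$, stop and return $(\bar x,\mathtt{UB})$; otherwise apply the augmentation step to $N_S$ and continue.
   Formalization: The makespan bound proved is ⌈(1+α)T*⌉, since T' is rounded up and the bound (1+α)T* can fail; T* > 0 is assumed (for T* = 0 the claim of 0 iterations fails); transit times are taken to be positive integers. *)

theory Defs
  imports Complex_Main
begin

section \<open>Universal packet routing\<close>

record ('v, 'k) upr =
  nodes :: "'v set"
  arcs :: "('v \<times> 'v) set"
  transit :: "'v \<times> 'v \<Rightarrow> nat"
  capacity :: "'v \<times> 'v \<Rightarrow> nat"
  storage :: "'v \<Rightarrow> nat"
  packets :: "'k set"
  origin :: "'k \<Rightarrow> 'v"
  dest :: "'k \<Rightarrow> 'v"

text \<open>Transit times are positive integers; capacities may be any natural numbers, including zero.\<close>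

definition upr_instance :: "('v, 'k) upr \<Rightarrow> bool" where
  "upr_instance I \<longleftrightarrow>
     finite (nodes I) \<and> arcs I \<subseteq> nodes I \<times> nodes I \<and>
     (\<forall>a\<in>arcs I. 0 < transit I a) \<and>
     finite (packets I) \<and>
     (\<forall>k\<in>packets I. origin I k \<in> nodes I \<and> dest I k \<in> nodes I)"

text \<open>The set \<open>\<K>\<^sub>v\<close> of packets that count towards the storage capacity of \<open>v\<close>.\<close>

definition packets_at :: "('v, 'k) upr \<Rightarrow> 'v \<Rightarrow> 'k set" where
  "packets_at I v = {k \<in> packets I. origin I k \<noteq> v \<and> dest I k \<noteq> v}"

text \<open>
  A trajectory is the list of its moves \<open>((v, w), d)\<close>: departure along the arc \<open>vw\<close> at time \<open>d\<close>.
  In the following functions the packet is at node \<open>v\<close> from time \<open>a\<close> on; between moves it waits.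
\<close>

type_synonym 'v move = "('v \<times> 'v) \<times> nat"

fun trajectory :: "('v, 'k) upr \<Rightarrow> 'v \<Rightarrow> nat \<Rightarrow> 'v move list \<Rightarrow> 'v \<Rightarrow> bool" where
  "trajectory I v a [] z \<longleftrightarrow> v = z"
| "trajectory I v a (((x, w), d) # ms) z \<longleftrightarrow>
     x = v \<and> (v, w) \<in> arcs I \<and> a \<le> d \<and> trajectory I w (d + transit I (v, w)) ms z"

fun arrival_time :: "('v, 'k) upr \<Rightarrow> nat \<Rightarrow> 'v move list \<Rightarrow> nat" where
  "arrival_time I a [] = a"
| "arrival_time I a ((e, d) # ms) = arrival_time I (d + transit I e) ms"

text \<open>
  \<open>waits_at I v a ms y \<theta>\<close>: the packet is held at \<open>y\<close> from time \<open>\<theta>\<close> to \<open>\<theta> + 1\<close>. Staying at the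
  destination after the last move is not recorded: such a packet is never in \<open>\<K>\<^sub>y\<close>.
\<close>

fun waits_at :: "('v, 'k) upr \<Rightarrow> 'v \<Rightarrow> nat \<Rightarrow> 'v move list \<Rightarrow> 'v \<Rightarrow> nat \<Rightarrow> bool" where
  "waits_at I v a [] y \<theta> \<longleftrightarrow> False"
| "waits_at I v a ((e, d) # ms) y \<theta> \<longleftrightarrow>
     (v = y \<and> a \<le> \<theta> \<and> \<theta> < d) \<or> waits_at I (snd e) (d + transit I e) ms y \<theta>"

definition feasible_routing :: "('v, 'k) upr \<Rightarrow> ('k \<Rightarrow> 'v move list) \<Rightarrow> bool" where
  "feasible_routing I R \<longleftrightarrow>
     (\<forall>k\<in>packets I. trajectory I (origin I k) 0 (R k) (dest I k)) \<and>
     (\<forall>a\<in>arcs I. \<forall>\<theta>. card {k \<in> packets I. (a, \<theta>) \<in> set (R k)} \<le> capacity I a) \<and>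
     (\<forall>v\<in>nodes I. \<forall>\<theta>.
        card {k \<in> packets_at I v. waits_at I (origin I k) 0 (R k) v \<theta>} \<le> storage I v)"

definition makespan :: "('v, 'k) upr \<Rightarrow> ('k \<Rightarrow> 'v move list) \<Rightarrow> nat" where
  "makespan I R = Max (insert 0 ((\<lambda>k. arrival_time I 0 (R k)) ` packets I))"

definition is_min_makespan :: "('v, 'k) upr \<Rightarrow> nat \<Rightarrow> bool" where
  "is_min_makespan I M \<longleftrightarrow>
     (\<exists>R. feasible_routing I R \<and> makespan I R = M) \<and>
     (\<forall>R. feasible_routing I R \<longrightarrow> M \<le> makespan I R)"

section \<open>Time-expanded networks\<close>

type_synonym 'v tnode = "'v \<times> nat"

text \<open>The two constructors keep the copies of a loop of the base graph apart from holdover arcs.\<close>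

datatype 'v tarc =
    is_movement: Movement (src: "'v tnode") (tgt: "'v tnode")
  | Holdover (src: "'v tnode") (tgt: "'v tnode")

definition full_nodes :: "('v, 'k) upr \<Rightarrow> nat \<Rightarrow> 'v tnode set" where
  "full_nodes I T = nodes I \<times> {0..T}"

definition full_moves :: "('v, 'k) upr \<Rightarrow> nat \<Rightarrow> 'v tarc set" where
  "full_moves I T =
     {Movement (v, t) (w, t + transit I (v, w)) | v w t.
        (v, w) \<in> arcs I \<and> t + transit I (v, w) \<le> T}"

definition full_holds :: "('v, 'k) upr \<Rightarrow> nat \<Rightarrow> 'v tarc set" where
  "full_holds I T = {Holdover (v, t) (v, t + 1) | v t. v \<in> nodes I \<and> t < T}"

text \<open>
  The functions \<open>n\<^sub>S\<close> and \<open>m\<^sub>S\<close>. No time follows the horizon \<open>T\<close>, so \<open>n\<^sub>S(v, T)\<close> is the minimum of the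
  empty set, an unspecified number. It only occurs in the capacities of movement arcs leaving
  \<open>(v, T)\<close>; using such an arc costs more than \<open>T\<close>.
\<close>

definition next_time :: "'v tnode set \<Rightarrow> 'v tnode \<Rightarrow> nat" where
  "next_time S n = Min {t'. snd n < t' \<and> (fst n, t') \<in> S}"

definition next_gap :: "'v tnode set \<Rightarrow> 'v tnode \<Rightarrow> nat" where
  "next_gap S n = next_time S n - snd n"

definition round_down :: "'v tnode set \<Rightarrow> 'v \<Rightarrow> nat \<Rightarrow> nat" where
  "round_down S w \<theta> = Max {t'. (w, t') \<in> S \<and> t' \<le> \<theta>}"

definition part_moves :: "('v, 'k) upr \<Rightarrow> 'v tnode set \<Rightarrow> 'v tarc set" where
  "part_moves I S =
     {Movement (v, t) (w, round_down S w (t + transit I (v, w))) | v w t.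
        (v, t) \<in> S \<and> (v, w) \<in> arcs I}"

definition part_holds :: "nat \<Rightarrow> 'v tnode set \<Rightarrow> 'v tarc set" where
  "part_holds T S = {Holdover (v, t) (v, next_time S (v, t)) | v t. (v, t) \<in> S \<and> t < T}"

text \<open>The base arc of a movement arc and the true arrival time \<open>t + \<tau>\<^sub>v\<^sub>w\<close>.\<close>

definition base_arc :: "'v tarc \<Rightarrow> 'v \<times> 'v" where
  "base_arc e = (fst (src e), fst (tgt e))"

definition true_arrival :: "('v, 'k) upr \<Rightarrow> 'v tarc \<Rightarrow> nat" where
  "true_arrival I e = snd (src e) + transit I (base_arc e)"

definition move_tails :: "'v tarc set \<Rightarrow> 'v tnode \<Rightarrow> 'v tnode set" where
  "move_tails E n = src ` {e \<in> E. tgt e = n}"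

definition part_move_cap :: "('v, 'k) upr \<Rightarrow> 'v tnode set \<Rightarrow> 'v tarc \<Rightarrow> nat" where
  "part_move_cap I S e = capacity I (base_arc e) * next_gap S (src e)"

text \<open>The capacity \<open>b'\<^sub>e\<close> of the holdover arc leaving \<open>n\<close>.\<close>

definition part_hold_slack :: "('v, 'k) upr \<Rightarrow> nat \<Rightarrow> 'v tnode set \<Rightarrow> 'v tnode \<Rightarrow> nat" where
  "part_hold_slack I T S n =
     (\<Sum>z \<in> move_tails (full_moves I T) n \<union> move_tails (part_moves I S) n.
        capacity I (fst z, fst n) * (next_gap S z - 1))"

definition part_hold_cap :: "('v, 'k) upr \<Rightarrow> nat \<Rightarrow> 'v tnode set \<Rightarrow> 'v tnode \<Rightarrow> nat" where
  "part_hold_cap I T S n =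
     (if (fst n, snd n + 1) \<in> S then storage I (fst n) else 2 * storage I (fst n))
     + part_hold_slack I T S n"

section \<open>The integer programs\<close>

text \<open>
  A solution \<open>x\<close> assigns \<open>x k e\<close> to every packet and arc and is extended by zero outside the
  network on which it is defined.
\<close>

type_synonym ('v, 'k) sol = "'k \<Rightarrow> 'v tarc \<Rightarrow> nat"

definition binary_on :: "'v tarc set \<Rightarrow> ('v tarc \<Rightarrow> nat) \<Rightarrow> bool" where
  "binary_on E f \<longleftrightarrow> (\<forall>e\<in>E. f e \<in> {0, 1}) \<and> (\<forall>e. e \<notin> E \<longrightarrow> f e = 0)"

definition unit_flow ::
    "'v tnode set \<Rightarrow> 'v tarc set \<Rightarrow> 'v tnode \<Rightarrow> 'v tnode \<Rightarrow> ('v tarc \<Rightarrow> nat) \<Rightarrow> bool" where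
  "unit_flow V E p q f \<longleftrightarrow>
     (\<forall>n\<in>V. int (\<Sum>e | e \<in> E \<and> src e = n. f e) - int (\<Sum>e | e \<in> E \<and> tgt e = n. f e)
           = of_bool (n = p) - of_bool (n = q))"

definition upr_DS_feasible ::
    "('v, 'k) upr \<Rightarrow> nat \<Rightarrow> 'v tnode set \<Rightarrow> ('v, 'k) sol \<Rightarrow> real \<Rightarrow> bool" where
  "upr_DS_feasible I T S x Tbar \<longleftrightarrow>
     (\<forall>k\<in>packets I. binary_on (part_moves I S \<union> part_holds T S) (x k)) \<and>
     (\<forall>k\<in>packets I. \<forall>e\<in>part_moves I S. real (true_arrival I e * x k e) \<le> Tbar) \<and>
     (\<forall>k\<in>packets I.
        real (\<Sum>e | e \<in> part_moves I S \<and> fst (tgt e) = dest I k. true_arrival I e * x k e) \<le> Tbar) \<and>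
     (\<forall>k\<in>packets I.
        unit_flow S (part_moves I S \<union> part_holds T S) (origin I k, 0) (dest I k, T) (x k)) \<and>
     (\<forall>e\<in>part_moves I S. (\<Sum>k\<in>packets I. x k e) \<le> part_move_cap I S e) \<and>
     (\<forall>e\<in>part_holds T S.
        (\<Sum>k\<in>packets_at I (fst (src e)). x k e) \<le> part_hold_cap I T S (src e))"

definition upr_DS_optimal ::
    "('v, 'k) upr \<Rightarrow> nat \<Rightarrow> 'v tnode set \<Rightarrow> ('v, 'k) sol \<Rightarrow> real \<Rightarrow> bool" where
  "upr_DS_optimal I T S x Tbar \<longleftrightarrow>
     upr_DS_feasible I T S x Tbar \<and>
     (\<forall>y Ubar. upr_DS_feasible I T S y Ubar \<longrightarrow> Tbar \<le> Ubar)"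

text \<open>
  A packet's trajectory in a solution on \<open>D\<^sub>S\<close> is a walk from \<open>(s\<^sub>k, 0)\<close> to \<open>(t\<^sub>k, T)\<close> along arcs that
  carry the packet. Because arrival times are rounded down, \<open>D\<^sub>S\<close> may have cycles and the support of
  \<open>x k\<close> may contain further closed walks; every such walk is admitted as the trajectory.
\<close>

fun twalk :: "'v tarc set \<Rightarrow> 'v tnode \<Rightarrow> 'v tarc list \<Rightarrow> 'v tnode \<Rightarrow> bool" where
  "twalk E n [] m \<longleftrightarrow> n = m"
| "twalk E n (e # es) m \<longleftrightarrow> e \<in> E \<and> src e = n \<and> twalk E (tgt e) es m"

definition underlying_path ::
    "('v, 'k) upr \<Rightarrow> nat \<Rightarrow> 'v tnode set \<Rightarrow> ('v, 'k) sol \<Rightarrow> 'k \<Rightarrow> ('v \<times> 'v) list \<Rightarrow> bool" where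
  "underlying_path I T S x k P \<longleftrightarrow>
     (\<exists>p. distinct p \<and>
          twalk {e \<in> part_moves I S \<union> part_holds T S. x k e = 1} (origin I k, 0) p (dest I k, T) \<and>
          P = map base_arc (filter is_movement p))"

text \<open>The origin is added explicitly because the path of a packet with \<open>s\<^sub>k = t\<^sub>k\<close> may have no arc.\<close>

definition path_nodes :: "('v, 'k) upr \<Rightarrow> 'k \<Rightarrow> ('v \<times> 'v) list \<Rightarrow> 'v set" where
  "path_nodes I k P = {origin I k} \<union> fst ` set P \<union> snd ` set P"

definition path_arcs :: "('v, 'k) upr \<Rightarrow> nat \<Rightarrow> 'k \<Rightarrow> ('v \<times> 'v) list \<Rightarrow> 'v tarc set" where
  "path_arcs I T' k P =
     {e \<in> full_moves I T'. base_arc e \<in> set P} \<union>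
     {e \<in> full_holds I T'. fst (src e) \<in> path_nodes I k P}"

definition upr_FP_feasible ::
    "('v, 'k) upr \<Rightarrow> nat \<Rightarrow> ('k \<Rightarrow> ('v \<times> 'v) list) \<Rightarrow> ('v, 'k) sol \<Rightarrow> real \<Rightarrow> bool" where
  "upr_FP_feasible I T' P x Tbar \<longleftrightarrow>
     (\<forall>k\<in>packets I. binary_on (path_arcs I T' k (P k)) (x k)) \<and>
     (\<forall>k\<in>packets I. \<forall>e\<in>full_moves I T'. real (snd (tgt e) * x k e) \<le> Tbar) \<and>
     (\<forall>k\<in>packets I.
        real (\<Sum>e | e \<in> full_moves I T' \<and> fst (tgt e) = dest I k. snd (tgt e) * x k e) \<le> Tbar) \<and>
     (\<forall>k\<in>packets I.
        unit_flow (full_nodes I T') (full_moves I T' \<union> full_holds I T')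
          (origin I k, 0) (dest I k, T') (x k)) \<and>
     (\<forall>e\<in>full_moves I T'. (\<Sum>k\<in>packets I. x k e) \<le> capacity I (base_arc e)) \<and>
     (\<forall>e\<in>full_holds I T'.
        (\<Sum>k\<in>packets_at I (fst (src e)). x k e) \<le> storage I (fst (src e)))"

definition upr_FP_optimal ::
    "('v, 'k) upr \<Rightarrow> nat \<Rightarrow> ('k \<Rightarrow> ('v \<times> 'v) list) \<Rightarrow> ('v, 'k) sol \<Rightarrow> real \<Rightarrow> bool" where
  "upr_FP_optimal I T' P x Tbar \<longleftrightarrow>
     upr_FP_feasible I T' P x Tbar \<and>
     (\<forall>y Ubar. upr_FP_feasible I T' P y Ubar \<longrightarrow> Tbar \<le> Ubar)"

section \<open>The algorithm\<close>

text \<open>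
  Optimal solutions and underlying paths need not be unique, so the steps are relations that admit
  every choice. The last two arguments of \<open>compute_UB\<close> are its results; \<open>None\<close> stands for
  \<open>\<emptyset>\<close>. The horizon \<open>T'\<close> is rounded up and the stopping test only uses \<open>UB\<close> and \<open>LB\<close>, so the
  returned makespan may be \<open>\<lceil>(1 + \<alpha>) T*\<rceil>\<close> even when this exceeds \<open>(1 + \<alpha>) T*\<close>.
\<close>

definition compute_UB ::
    "('v, 'k) upr \<Rightarrow> nat \<Rightarrow> 'v tnode set \<Rightarrow> ('v, 'k) sol \<Rightarrow> real \<Rightarrow> real \<Rightarrow> real
      \<Rightarrow> real \<Rightarrow> ('v, 'k) sol option \<Rightarrow> bool" where
  "compute_UB I T S xh Th \<alpha> UB UB' res \<longleftrightarrow>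
     (\<exists>P. (\<forall>k\<in>packets I. underlying_path I T S xh k (P k)) \<and>
       (let T' = nat \<lceil>(1 + \<alpha>) * Th\<rceil> in
         if \<exists>y Ubar. upr_FP_feasible I T' P y Ubar
         then \<exists>x Tbar. upr_FP_optimal I T' P x Tbar \<and> UB' = min UB Tbar \<and> res = Some x
         else UB' = UB \<and> res = None))"

text \<open>All nodes added in one augmentation step are determined by the current \<open>N\<^sub>S\<close>.\<close>

definition augment ::
    "('v, 'k) upr \<Rightarrow> nat \<Rightarrow> 'v tnode set \<Rightarrow> ('v, 'k) sol \<Rightarrow> 'v tnode set" where
  "augment I T S xh =
     S
     \<union> {(w, t + transit I (v, w)) | v t w t'.
          Movement (v, t) (w, t') \<in> part_moves I S \<and>
          (\<Sum>k\<in>packets I. xh k (Movement (v, t) (w, t'))) > 0 \<and>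
          t' < t + transit I (v, w)}
     \<union> {(v, t + 1) | v t w t'.
          Movement (v, t) (w, t') \<in> part_moves I S \<and>
          (\<Sum>k\<in>packets I. xh k (Movement (v, t) (w, t'))) > capacity I (v, w)}
     \<union> {(z, r + 1) | z r v t t'.
          Holdover (v, t) (v, t') \<in> part_holds T S \<and>
          (\<Sum>k\<in>packets_at I v. xh k (Holdover (v, t) (v, t'))) > storage I v \<and>
          (z, r) \<in> move_tails (full_moves I T) (v, t) \<and> next_gap S (z, r) > 1}
     \<union> {(v, t + 1) | v t t'.
          Holdover (v, t) (v, t') \<in> part_holds T S \<and>
          (\<Sum>k\<in>packets_at I v. xh k (Holdover (v, t) (v, t'))) > storage I v}"

text \<open>The state before an iteration consists of \<open>N\<^sub>S\<close>, \<open>UB\<close> and \<open>LB\<close>.\<close>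

type_synonym 'v state = "'v tnode set \<times> real \<times> real"

datatype ('v, 'k) outcome =
    Return "('v, 'k) sol" real
  | Continue "'v state"

inductive ddd_iteration ::
    "('v, 'k) upr \<Rightarrow> nat \<Rightarrow> real \<Rightarrow> 'v state \<Rightarrow> ('v, 'k) outcome \<Rightarrow> bool"
  for I T \<alpha> where
  stop:
    "\<lbrakk>upr_DS_optimal I T S xh Th; LB' = max LB Th;
      compute_UB I T S xh Th \<alpha> UB UB' (Some xb); (UB' - LB') / UB' \<le> \<alpha>\<rbrakk>
     \<Longrightarrow> ddd_iteration I T \<alpha> (S, UB, LB) (Return xb UB')"
| continue:
    "\<lbrakk>upr_DS_optimal I T S xh Th; LB' = max LB Th;
      compute_UB I T S xh Th \<alpha> UB UB' res; \<not> ((UB' - LB') / UB' \<le> \<alpha> \<and> res \<noteq> None)\<rbrakk>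
     \<Longrightarrow> ddd_iteration I T \<alpha> (S, UB, LB) (Continue (augment I T S xh, UB', LB'))"

text \<open>
  \<open>ddd_reaches I T \<alpha> n \<sigma>\<close>: some run of UPR-DDD is in state \<open>\<sigma>\<close> after \<open>n\<close> iterations, none of
  which has stopped.
\<close>

inductive ddd_reaches ::
    "('v, 'k) upr \<Rightarrow> nat \<Rightarrow> real \<Rightarrow> nat \<Rightarrow> 'v state \<Rightarrow> bool"
  for I T \<alpha> where
  init: "ddd_reaches I T \<alpha> 0 (nodes I \<times> {0, T}, real T, 0)"
| step: "\<lbrakk>ddd_reaches I T \<alpha> n \<sigma>; ddd_iteration I T \<alpha> \<sigma> (Continue \<sigma>')\<rbrakk>
         \<Longrightarrow> ddd_reaches I T \<alpha> (Suc n) \<sigma>'"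

text \<open>The routing \<open>R\<close> makes exactly the moves selected by the solution \<open>x\<close> on \<open>D\<^sub>T\<^sub>'\<close>.\<close>

definition routing_of :: "('v, 'k) upr \<Rightarrow> ('v, 'k) sol \<Rightarrow> ('k \<Rightarrow> 'v move list) \<Rightarrow> bool" where
  "routing_of I x R \<longleftrightarrow>
     (\<forall>k\<in>packets I. set (R k) =
        {((v, w), d) | v w d.
           (v, w) \<in> arcs I \<and> x k (Movement (v, d) (w, d + transit I (v, w))) = 1})"

end

theory Submission
  imports Defs
begin

text \<open>
  Rounding every departure of an optimal routing down to a time present in \<open>N\<^sub>S\<close> turns it into a
  solution of \<open>UPR(D\<^sub>S)\<close>, so every lower bound is at most \<open>T*\<close> and the returned routing fits the
  horizon \<open>\<lceil>(1 + \<alpha>) T*\<rceil>\<close>. Since an optimal solution of \<open>UPR(D\<^sub>S)\<close> only uses arcs with true arrival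
  time at most \<open>T*\<close>, all new nodes lie in \<open>N \<times> {1..T*}\<close>. If the augmentation step adds no node, then
  the solution respects the true transit times and capacities; hence the fixed-path problem attains
  the lower bound and the algorithm stops. So each iteration that continues adds a node. The bound is
  strict because one node is gained at the start: if \<open>T = T*\<close>, the nodes \<open>(v, T*)\<close> are present from
  the beginning, and otherwise a first iteration that continues adds two nodes.
\<close>

section \<open>Walks and unit flows\<close>

text \<open>One construction serves both networks: \<open>full_nodes I T'\<close> is itself an
  instance of \<open>partial_network\<close>, with rounding as the identity, so
  \<open>trajectory_walk\<close> yields solutions of UPR(\<open>D\<^sub>S\<close>) and of the
  fixed-path problem alike. Each departure is rounded from its true time, not from the previous
  rounded arrival, so rounding errors do not add up along a path. The obstacle is that a rounded arc
  need not advance in time. \<open>D\<^sub>S\<close> may have cycles, and the support of an optimal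
  solution may exceed a single path. Paths are therefore extracted by a cut argument that tolerates
  cycles, and later arguments hold for every choice of path. An exact support is needed only in the
  fully expanded network, where time increases along arcs. A solution that triggers no new node
  makes the gap nonpositive, so the stopping test succeeds for every \<alpha>. The returned makespan
  is controlled by the horizon of the fixed-path problem and not by the gap. Since \<open>n\<close>
  counts completed iterations, the strict bound on \<open>n\<close> puts the stopping iteration at
  number |N| times the minimum makespan at the latest.\<close>

lemma twalk_append:
  "twalk E n (p @ q) m \<longleftrightarrow> (\<exists>r. twalk E n p r \<and> twalk E r q m)"
  by (induction p arbitrary: n) auto

lemma twalk_subset: "twalk E n p m \<Longrightarrow> set p \<subseteq> E"
  by (induction p arbitrary: n; simp; blast)

lemma twalk_mono: "twalk E n p m \<Longrightarrow> set p \<subseteq> F \<Longrightarrow> twalk F n p m"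
  by (induction p arbitrary: n) auto

lemma twalk_suffix:
  assumes "twalk E n p m" "r \<in> set (n # map tgt p)" "distinct (n # map tgt p)"
  shows "\<exists>q. twalk E r q m \<and> distinct (r # map tgt q) \<and> set q \<subseteq> set p"
  using assms
proof (induction p arbitrary: n)
  case Nil
  then show ?case by (intro exI[of _ "[]"]) auto
next
  case (Cons e p)
  show ?case
  proof (cases "r = n")
    case True
    with Cons.prems show ?thesis by (intro exI[of _ "e # p"]) auto
  next
    case False
    with Cons.prems Cons.IH[of "tgt e"] obtain q
      where "twalk E r q m" "distinct (r # map tgt q)" "set q \<subseteq> set p" by auto
    then show ?thesis by (intro exI[of _ q]) auto
  qed
qed

text \<open>Loop erasure: an arc is prepended to the shortened rest, unless its tail already occurs
  there; then only the suffix from that occurrence is kept.\<close>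

lemma twalk_simple:
  assumes "twalk E n p m"
  obtains q where "twalk E n q m" "distinct q" "set q \<subseteq> set p"
proof -
  \<comment> \<open>The induction needs distinct nodes, which is stronger than distinct
    arcs.\<close>
  have "\<exists>q. twalk E n q m \<and> distinct (n # map tgt q) \<and> set q \<subseteq> set p"
    using assms
  proof (induction p arbitrary: n)
    case Nil
    then show ?case by (intro exI[of _ "[]"]) auto
  next
    case (Cons e p)
    then obtain q where q: "twalk E (tgt e) q m" "distinct (tgt e # map tgt q)" "set q \<subseteq> set p"
      by fastforce
    show ?case
    proof (cases "n \<in> set (tgt e # map tgt q)")
      case True
      from twalk_suffix[OF q(1) True q(2)] q(3) show ?thesis by (metis dual_order.trans set_subset_Cons)
    next
      case False
      with q Cons.prems show ?thesis by (intro exI[of _ "e # q"]) auto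
    qed
  qed
  then show thesis using that by (metis distinct.simps(2) distinct_map)
qed

lemma twalk_degree:
  assumes "twalk E p es q"
  shows "int (length (filter (\<lambda>e. src e = n) es)) - int (length (filter (\<lambda>e. tgt e = n) es))
           = of_bool (n = p) - of_bool (n = q)"
  using assms
proof (induction es arbitrary: p)
  case (Cons e es)
  then have "e \<in> E" "src e = p" and walk: "twalk E (tgt e) es q" by auto
  then show ?case using Cons.IH[OF walk] by auto
qed simp

lemma sum_of_bool_list:
  assumes "finite E" "set es \<subseteq> E" "distinct es"
  shows "(\<Sum>e | e \<in> E \<and> P e. of_bool (e \<in> set es)) = length (filter P es)"
proof -
  have "(\<Sum>e | e \<in> E \<and> P e. of_bool (e \<in> set es)) = card ({e \<in> E. P e} \<inter> set es)"
    using assms(1) by (simp add: of_bool_def sum.If_cases)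
  also have "{e \<in> E. P e} \<inter> set es = set (filter P es)" using assms(2) by auto
  also have "card \<dots> = length (filter P es)" using assms(3) by (intro distinct_card) simp
  finally show ?thesis .
qed

text \<open>A node may be visited repeatedly; distinct arcs suffice for the indicator to agree with
  the number of traversals.\<close>

lemma unit_flow_walk:
  assumes "finite E" "twalk E p es q" "distinct es"
  shows "unit_flow V E p q (\<lambda>e. of_bool (e \<in> set es))"
  unfolding unit_flow_def
proof
  fix n
  have sub: "set es \<subseteq> E" using assms(2) by (rule twalk_subset)
  show "int (\<Sum>e | e \<in> E \<and> src e = n. of_bool (e \<in> set es))
      - int (\<Sum>e | e \<in> E \<and> tgt e = n. of_bool (e \<in> set es)) = of_bool (n = p) - of_bool (n = q)"
    unfolding sum_of_bool_list[OF assms(1) sub assms(3)] by (rule twalk_degree[OF assms(2)])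
qed

text \<open>Cut argument: let \<open>X\<close> be the nodes reachable from \<open>p\<close> along
  used arcs. If \<open>q\<close> were outside, conservation summed over \<open>X\<close> would give
  net outflow 1, although every used arc leaving a node of \<open>X\<close> ends in
  \<open>X\<close>. Cycles in the support do no harm.\<close>

lemma unit_flow_path:
  assumes fin: "finite V" "finite E" and V: "tgt ` E \<subseteq> V" "p \<in> V"
    and flow: "unit_flow V E p q f" and bin: "binary_on E f"
  obtains es where "distinct es" "twalk {e \<in> E. f e = 1} p es q"
proof -
  define F where "F = {e \<in> E. f e = 1}"
  define X where "X = {n \<in> V. \<exists>es. twalk F p es n}"
  have pX: "p \<in> X" unfolding X_def using V(2) by (auto intro: exI[of _ "[]"])
  have step: "tgt e \<in> X" if e: "e \<in> E" "src e \<in> X" "f e \<noteq> 0" for e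
  proof -
    obtain es where "twalk F p es (src e)" using e(2) unfolding X_def by auto
    moreover have "e \<in> F" unfolding F_def using e bin unfolding binary_on_def by auto
    ultimately have "twalk F p (es @ [e]) (tgt e)"
      unfolding twalk_append by (intro exI[of _ "src e"]) simp
    then show ?thesis unfolding X_def using e(1) V(1) by auto
  qed
  have XV: "X \<subseteq> V" and finX: "finite X" unfolding X_def using fin(1) by auto
  have grp: "(\<Sum>n\<in>X. \<Sum>e | e \<in> E \<and> g e = n. f e) = (\<Sum>e | e \<in> E \<and> g e \<in> X. f e)" for g
  proof -
    have "(\<Sum>n\<in>X. \<Sum>e | e \<in> E \<and> g e = n. f e) = (\<Sum>n\<in>X. sum f {e \<in> {e \<in> E. g e \<in> X}. g e = n})"
      by (intro sum.cong refl arg_cong2[where f = sum]) auto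
    also have "\<dots> = sum f {e \<in> E. g e \<in> X}"
      using fin(2) finX by (intro sum.group) auto
    finally show ?thesis by simp
  qed
  have "q \<in> X"
  proof (rule ccontr)
    assume q: "q \<notin> X"
    have "(\<Sum>n\<in>X. int (\<Sum>e | e \<in> E \<and> src e = n. f e) - int (\<Sum>e | e \<in> E \<and> tgt e = n. f e))
        = (\<Sum>n\<in>X. of_bool (n = p) - of_bool (n = q))"
    proof (intro sum.cong refl)
      fix n assume "n \<in> X"
      then have "n \<in> V" using XV by auto
      then show "int (\<Sum>e | e \<in> E \<and> src e = n. f e) - int (\<Sum>e | e \<in> E \<and> tgt e = n. f e)
          = of_bool (n = p) - of_bool (n = q)"
        using flow unfolding unit_flow_def by blast
    qed
    also have "\<dots> = (\<Sum>n\<in>X. of_bool (n = p))"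
      using q by (intro sum.cong) auto
    also have "\<dots> = 1" using pX finX by (simp add: of_bool_def)
    finally have "int (\<Sum>e | e \<in> E \<and> src e \<in> X. f e) - int (\<Sum>e | e \<in> E \<and> tgt e \<in> X. f e) = 1"
      by (simp only: sum_subtractf int_sum[symmetric] grp)
    moreover have "(\<Sum>e | e \<in> E \<and> src e \<in> X. f e) \<le> (\<Sum>e | e \<in> E \<and> tgt e \<in> X. f e)"
    proof -
      have "(\<Sum>e | e \<in> E \<and> src e \<in> X. f e) = (\<Sum>e | e \<in> E \<and> src e \<in> X \<and> f e \<noteq> 0. f e)"
        using fin(2) by (intro sum.mono_neutral_right) auto
      also have "\<dots> \<le> (\<Sum>e | e \<in> E \<and> tgt e \<in> X. f e)"
        using fin(2) step by (intro sum_mono2) auto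
      finally show ?thesis .
    qed
    ultimately show False by linarith
  qed
  then obtain es where "twalk F p es q" unfolding X_def by auto
  then obtain es' where "twalk F p es' q" "distinct es'" by (rule twalk_simple)
  then show thesis using that unfolding F_def by blast
qed

text \<open>Subtracting the walk leaves a circulation, which vanishes because time increases along arcs.\<close>

lemma acyclic_flow_support:
  assumes fin: "finite E" and V: "src ` E \<subseteq> V"
    and flow: "unit_flow V E p q f" and bin: "binary_on E f"
    and time: "\<And>e. e \<in> E \<Longrightarrow> snd (src e) < snd (tgt e)"
    and walk: "twalk {e \<in> E. f e = 1} p es q" "distinct es"
  shows "{e. f e = 1} = set es"
proof
  have sub: "set es \<subseteq> {e \<in> E. f e = 1}" using walk(1) by (rule twalk_subset)
  then show "set es \<subseteq> {e. f e = 1}" by auto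
  define g :: "'a tarc \<Rightarrow> nat" where "g e = of_bool (e \<in> set es)" for e
  have "twalk E p es q" by (rule twalk_mono[OF walk(1)]) (use sub in blast)
  then have gflow: "unit_flow V E p q g" unfolding g_def
    by (intro unit_flow_walk fin walk(2))
  have gf: "g e \<le> f e" for e using sub unfolding g_def by auto
  \<comment> \<open>Arcs into \<open>src e\<close> start strictly earlier, so the inflows of
    \<open>f\<close> and \<open>g\<close> agree by induction; equal outflow sums and
    \<open>g\<close> below \<open>f\<close> then force equality on each arc.\<close>
  have eq: "f e = g e" if "e \<in> E" for e
    using that
  proof (induction "snd (src e)" arbitrary: e rule: less_induct)
    case less
    have inn: "(\<Sum>e' | e' \<in> E \<and> tgt e' = src e. f e') = (\<Sum>e' | e' \<in> E \<and> tgt e' = src e. g e')"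
    proof (intro sum.cong refl)
      fix e' assume "e' \<in> {e' \<in> E. tgt e' = src e}"
      then have "e' \<in> E" "snd (src e') < snd (src e)" using time[of e'] by simp_all
      then show "f e' = g e'" using less.hyps by blast
    qed
    have "src e \<in> V" using V less.prems by auto
    then have "(\<Sum>e' | e' \<in> E \<and> src e' = src e. f e') = (\<Sum>e' | e' \<in> E \<and> src e' = src e. g e')"
    proof -
      have "int (\<Sum>e' | e' \<in> E \<and> src e' = src e. f e') - int (\<Sum>e' | e' \<in> E \<and> tgt e' = src e. f e')
          = int (\<Sum>e' | e' \<in> E \<and> src e' = src e. g e') - int (\<Sum>e' | e' \<in> E \<and> tgt e' = src e. g e')"
        using bspec[OF flow[unfolded unit_flow_def] \<open>src e \<in> V\<close>]
          bspec[OF gflow[unfolded unit_flow_def] \<open>src e \<in> V\<close>] by (rule trans[OF _ sym])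
      then show ?thesis using inn by linarith
    qed
    then have "g e = f e"
      using gf fin less.prems by (intro sum_mono_inv[of g "{e' \<in> E. src e' = src e}" f e]) simp_all
    then show ?case by simp
  qed
  show "{e. f e = 1} \<subseteq> set es"
  proof
    fix e assume e: "e \<in> {e. f e = 1}"
    then have "e \<in> E" using bin unfolding binary_on_def by fastforce
    then show "e \<in> set es" using eq[of e] e unfolding g_def by (cases "e \<in> set es") auto
  qed
qed

section \<open>Trajectories\<close>

lemma trajectory_earlier:
  "trajectory I v b ms z \<Longrightarrow> a \<le> b \<Longrightarrow> trajectory I v a ms z"
  by (cases ms) auto

lemma arrival_time_mono: "a \<le> b \<Longrightarrow> arrival_time I a ms \<le> arrival_time I b ms"
  by (cases ms) auto

lemma arrival_time_ge: "trajectory I v a ms z \<Longrightarrow> a \<le> arrival_time I a ms"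
  by (induction I v a ms z rule: trajectory.induct) auto

lemma move_le_arrival_time:
  "trajectory I v a ms z \<Longrightarrow> (e, d) \<in> set ms \<Longrightarrow>
     e \<in> arcs I \<and> d + transit I e \<le> arrival_time I a ms"
  by (induction I v a ms z rule: trajectory.induct) (auto dest: arrival_time_ge)

lemma waits_at_earlier:
  "waits_at I v a ms y \<theta> \<Longrightarrow> waits_at I v b ms y \<theta> \<or> v = y \<and> a \<le> \<theta> \<and> \<theta> < b"
  by (cases ms) auto

text \<open>
  Needed because the objective of \<open>UPR(D\<^sub>S)\<close> sums over all arcs that enter the destination, so a
  packet passing through its destination would be charged more than its arrival time.
\<close>

lemma trajectory_truncate:
  assumes "trajectory I v a ms z"
  shows "\<exists>ms'. trajectory I v a ms' z \<and> set ms' \<subseteq> set ms \<and>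
           arrival_time I a ms' \<le> arrival_time I a ms \<and>
           (\<forall>y \<theta>. waits_at I v a ms' y \<theta> \<longrightarrow> waits_at I v a ms y \<theta>) \<and>
           (\<exists>m\<^sub>0. \<forall>m\<in>set ms'. snd (fst m) = z \<longrightarrow> m = m\<^sub>0) \<and> (v = z \<longrightarrow> ms' = [])"
  using assms
proof (induction ms arbitrary: v a)
  case Nil
  then show ?case by (intro exI[of _ "[]"]) auto
next
  case (Cons m ms)
  obtain x w d where m: "m = ((x, w), d)" by (metis surj_pair)
  show ?case
  proof (cases "v = z")
    case True
    then show ?thesis using arrival_time_ge[OF Cons.prems] by (intro exI[of _ "[]"]) auto
  next
    case False
    obtain ms' m0 where ms': "trajectory I w (d + transit I (v, w)) ms' z" "set ms' \<subseteq> set ms"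
      "arrival_time I (d + transit I (v, w)) ms' \<le> arrival_time I (d + transit I (v, w)) ms"
      "\<And>y \<theta>. waits_at I w (d + transit I (v, w)) ms' y \<theta> \<Longrightarrow> waits_at I w (d + transit I (v, w)) ms y \<theta>"
      "\<forall>m\<in>set ms'. snd (fst m) = z \<longrightarrow> m = m0" "w = z \<longrightarrow> ms' = []"
      using Cons.IH[of w "d + transit I (v, w)"] Cons.prems m by auto
    have "\<exists>m\<^sub>0. \<forall>m'\<in>set (m # ms'). snd (fst m') = z \<longrightarrow> m' = m\<^sub>0"
      by (rule exI[of _ "if w = z then m else m0"]) (use ms'(5,6) m in auto)
    then show ?thesis
      using ms' m Cons.prems False by (intro exI[of _ "m # ms'"]) auto
  qed
qed

lemma makespan_le_iff:
  assumes "finite (packets I)"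
  shows "makespan I R \<le> M \<longleftrightarrow> (\<forall>k\<in>packets I. arrival_time I 0 (R k) \<le> M)"
  using assms unfolding makespan_def by simp

text \<open>The arcs along which a walk can be read as a trajectory. Holdover arcs may have any
  length, which covers both \<open>D\<^sub>S\<close> and the fully expanded network.\<close>

fun exact_arc :: "('v, 'k) upr \<Rightarrow> 'v tarc \<Rightarrow> bool" where
  "exact_arc I (Movement (v, t) (w, t')) \<longleftrightarrow> (v, w) \<in> arcs I \<and> t' = t + transit I (v, w)"
| "exact_arc I (Holdover (v, t) (w, t')) \<longleftrightarrow> w = v \<and> t \<le> t'"

definition moves_of :: "'v tarc list \<Rightarrow> 'v move list" where
  "moves_of p = map (\<lambda>e. (base_arc e, snd (src e))) (filter is_movement p)"

text \<open>Arrival time and waits are only bounded from above, because holdover arcs after the last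
  movement leave no trace in \<open>moves_of p\<close>.\<close>

lemma exact_walk:
  assumes "twalk E (v, a) p (z, b)" "\<And>e. e \<in> set p \<Longrightarrow> exact_arc I e"
  shows "trajectory I v a (moves_of p) z \<and> arrival_time I a (moves_of p) \<le> b \<and>
    (\<forall>y \<theta>. waits_at I v a (moves_of p) y \<theta> \<longrightarrow>
       (\<exists>t t'. Holdover (y, t) (y, t') \<in> set p \<and> t \<le> \<theta> \<and> \<theta> < t'))"
  using assms
proof (induction p arbitrary: v a)
  case Nil
  then show ?case by (simp add: moves_of_def)
next
  case (Cons e p)
  obtain w c where e: "tgt e = (w, c)" by fastforce
  have IH: "trajectory I w c (moves_of p) z" "arrival_time I c (moves_of p) \<le> b"
    "\<And>y \<theta>. waits_at I w c (moves_of p) y \<theta> \<Longrightarrow>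
       \<exists>t t'. Holdover (y, t) (y, t') \<in> set p \<and> t \<le> \<theta> \<and> \<theta> < t'"
    using Cons.IH[of w c] Cons.prems e by auto
  have "src e = (v, a)" "exact_arc I e" using Cons.prems by auto
  then consider (mov) "e = Movement (v, a) (w, c)" "(v, w) \<in> arcs I" "c = a + transit I (v, w)"
    | (hold) "e = Holdover (v, a) (v, c)" "w = v" "a \<le> c"
    using e by (cases e) auto
  then show ?case
  proof cases
    case mov
    then have "moves_of (e # p) = ((v, w), a) # moves_of p" by (simp add: moves_of_def base_arc_def)
    then show ?thesis using IH mov by fastforce
  next
    case hold
    then have m: "moves_of (e # p) = moves_of p" by (simp add: moves_of_def)
    have "\<exists>t t'. Holdover (y, t) (y, t') \<in> set (e # p) \<and> t \<le> \<theta> \<and> \<theta> < t'"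
      if w: "waits_at I v a (moves_of p) y \<theta>" for y \<theta>
      \<comment> \<open>Starting at \<open>a\<close> instead of \<open>c\<close> adds only waits in
        between, and these are covered by the holdover arc \<open>e\<close>.\<close>
      using waits_at_earlier[OF w, of c] IH(3)[of y \<theta>] hold by auto
    then show ?thesis
      using IH hold trajectory_earlier[OF IH(1), of a] arrival_time_mono[of a c I "moves_of p"] m
      by (auto simp del: set_simps)
  qed
qed

section \<open>Partially time-expanded networks\<close>

text \<open>The copies at 0 and \<open>T\<close> guarantee that rounding down always has a target
  and that every time before \<open>T\<close> has a next copy.\<close>

locale partial_network =
  fixes I :: "('v, 'k) upr" and T :: nat and S :: "'v tnode set"
  assumes inst: "upr_instance I"
    and lower: "nodes I \<times> {0, T} \<subseteq> S"
    and upper: "S \<subseteq> full_nodes I T"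
begin

abbreviation "rd \<equiv> round_down S"
abbreviation "next_at v t \<equiv> next_time S (v, t)"
abbreviation "net \<equiv> part_moves I S \<union> part_holds T S"

lemma instance_facts:
  "finite (nodes I)" "finite (packets I)" "finite (packets_at I v)"
  "(v, w) \<in> arcs I \<Longrightarrow> v \<in> nodes I" "(v, w) \<in> arcs I \<Longrightarrow> w \<in> nodes I"
  "(v, w) \<in> arcs I \<Longrightarrow> 0 < transit I (v, w)"
  "k \<in> packets I \<Longrightarrow> origin I k \<in> nodes I" "k \<in> packets I \<Longrightarrow> dest I k \<in> nodes I"
  using inst unfolding upr_instance_def packets_at_def by auto

lemma S_iff_bounds: "(v, t) \<in> S \<Longrightarrow> v \<in> nodes I \<and> t \<le> T"
  using upper unfolding full_nodes_def by auto

lemma finite_S: "finite S"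
  using upper instance_facts(1) unfolding full_nodes_def by (auto intro: finite_subset)

lemma finite_times: "finite {t. (v, t) \<in> S \<and> P t}"
  by (rule finite_subset[of _ "{0..T}"]) (auto dest: S_iff_bounds)

lemma rd_mem: "v \<in> nodes I \<Longrightarrow> (v, rd v \<theta>) \<in> S \<and> rd v \<theta> \<le> \<theta>"
proof -
  assume "v \<in> nodes I"
  then have "0 \<in> {t. (v, t) \<in> S \<and> t \<le> \<theta>}" using lower by auto
  then have "{t. (v, t) \<in> S \<and> t \<le> \<theta>} \<noteq> {}" by blast
  from Max_in[OF finite_times this] show ?thesis unfolding round_down_def by simp
qed

lemma rd_ge: "(v, t) \<in> S \<Longrightarrow> t \<le> \<theta> \<Longrightarrow> t \<le> rd v \<theta>"
  unfolding round_down_def by (intro Max_ge finite_times) simp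

lemma rd_exact: "(v, \<theta>) \<in> S \<Longrightarrow> rd v \<theta> = \<theta>"
  using rd_ge[of v \<theta> \<theta>] rd_mem[of v \<theta>] S_iff_bounds by fastforce

lemma finite_later: "finite {t'. t < t' \<and> (v, t') \<in> S}"
  using finite_times[of v "\<lambda>t'. t < t'"] by (simp add: conj_commute)

lemma next_mem:
  assumes "v \<in> nodes I" "t < T"
  shows "(v, next_at v t) \<in> S" "t < next_at v t"
proof -
  have "T \<in> {t'. t < t' \<and> (v, t') \<in> S}" using assms lower by auto
  then have "{t'. t < t' \<and> (v, t') \<in> S} \<noteq> {}" by blast
  from Min_in[OF finite_later this]
  show "(v, next_at v t) \<in> S" "t < next_at v t" unfolding next_time_def by simp_all
qed

lemma next_le: "(v, t') \<in> S \<Longrightarrow> t < t' \<Longrightarrow> next_at v t \<le> t'"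
  unfolding next_time_def using finite_later by (simp add: Min_le)

lemma next_Suc: "(v, t + 1) \<in> S \<Longrightarrow> next_at v t = t + 1"
  using next_le[of v "t + 1" t] next_mem[of v t] S_iff_bounds[of v "t + 1"] by fastforce

lemma less_next_rd:
  assumes "v \<in> nodes I" "\<theta> < T"
  shows "\<theta> < next_at v (rd v \<theta>)"
proof (rule ccontr)
  assume "\<not> \<theta> < next_at v (rd v \<theta>)"
  moreover have "rd v \<theta> < T" using rd_mem[OF assms(1), of \<theta>] assms(2) by linarith
  ultimately show False
    using next_mem[OF assms(1), of "rd v \<theta>"] rd_ge[of v "next_at v (rd v \<theta>)" \<theta>] by linarith
qed

lemma finite_net: "finite (part_moves I S)" "finite (part_holds T S)" "finite net"
proof -
  have "finite (arcs I)" using inst unfolding upr_instance_def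
    by (auto intro: finite_subset[of _ "nodes I \<times> nodes I"])
  moreover have "part_moves I S \<subseteq> (\<lambda>((v, t), w). Movement (v, t) (w, rd w (t + transit I (v, w)))) ` (S \<times> snd ` arcs I)"
    unfolding part_moves_def by force
  ultimately show "finite (part_moves I S)"
    using finite_S by (meson finite_SigmaI finite_imageI finite_subset)
  have "part_holds T S \<subseteq> (\<lambda>(v, t). Holdover (v, t) (v, next_at v t)) ` S"
    unfolding part_holds_def by force
  then show "finite (part_holds T S)"
    using finite_S by (meson finite_imageI finite_subset)
  then show "finite net" using \<open>finite (part_moves I S)\<close> by simp
qed

lemma tgt_net: "tgt ` net \<subseteq> S"
proof
  fix n assume "n \<in> tgt ` net"
  then obtain e where e: "e \<in> net" "n = tgt e" by blast
  show "n \<in> S"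
  proof (cases "e \<in> part_moves I S")
    case True
    then show ?thesis unfolding part_moves_def using e(2) rd_mem instance_facts(5) by auto
  next
    case False
    then show ?thesis using e next_mem S_iff_bounds unfolding part_holds_def by auto
  qed
qed

lemma part_movesI: "(v, t) \<in> S \<Longrightarrow> (v, w) \<in> arcs I \<Longrightarrow>
    Movement (v, t) (w, rd w (t + transit I (v, w))) \<in> part_moves I S"
  unfolding part_moves_def by auto

lemma part_holdsI: "(v, t) \<in> S \<Longrightarrow> t < T \<Longrightarrow> Holdover (v, t) (v, next_at v t) \<in> part_holds T S"
  unfolding part_holds_def by auto

lemma is_movement_part: "e \<in> part_moves I S \<Longrightarrow> is_movement e" "e \<in> part_holds T S \<Longrightarrow> \<not> is_movement e"
  unfolding part_moves_def part_holds_def by auto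

section \<open>Rounding a trajectory to a walk in the partial network\<close>

lemma holdover_walk:
  assumes "(v, a) \<in> S" "(v, b) \<in> S" "a \<le> b"
  shows "\<exists>p. twalk net (v, a) p (v, b) \<and>
    (\<forall>e\<in>set p. \<exists>t. e = Holdover (v, t) (v, next_at v t) \<and> a \<le> t \<and> next_at v t \<le> b)"
  using assms
proof (induction "b - a" arbitrary: a rule: less_induct)
  case less
  show ?case
  proof (cases "a = b")
    case True
    then show ?thesis by (intro exI[of _ "[]"]) simp
  next
    case False
    then have a: "a < b" "a < T" "v \<in> nodes I" using less.prems S_iff_bounds by fastforce+
    note nxt = next_mem[OF a(3,2)] next_le[OF less.prems(2) a(1)]
    obtain p where p: "twalk net (v, next_at v a) p (v, b)"
      "\<forall>e\<in>set p. \<exists>t. e = Holdover (v, t) (v, next_at v t) \<and> next_at v a \<le> t \<and> next_at v t \<le> b"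
      using less.hyps[OF _ nxt(1) less.prems(2) nxt(3)] nxt(2,3) by (meson diff_less_mono2 less_le_trans)
    then show ?thesis
      using nxt part_holdsI[OF less.prems(1) a(2)]
      by (intro exI[of _ "Holdover (v, a) (v, next_at v a) # p"]) fastforce
  qed
qed

text \<open>
  \<open>visit_holds W ms y t\<close> says why a packet with moves \<open>ms\<close> uses the holdover arc leaving \<open>(y, t)\<close>:
  its rounded arrival at \<open>y\<close> is at most \<open>t\<close>, and it stays until the next copy of \<open>y\<close> or longer.
\<close>

definition visit_holds :: "('v \<Rightarrow> nat \<Rightarrow> bool) \<Rightarrow> 'v move list \<Rightarrow> 'v \<Rightarrow> nat \<Rightarrow> bool" where
  "visit_holds W ms y t \<longleftrightarrow> (\<exists>u d\<^sub>0 d. ((u, y), d\<^sub>0) \<in> set ms \<and>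
     rd y (rd u d\<^sub>0 + transit I (u, y)) \<le> t \<and> next_at y t \<le> d \<and>
     (\<forall>\<theta>. d\<^sub>0 + transit I (u, y) \<le> \<theta> \<longrightarrow> \<theta> < d \<longrightarrow> W y \<theta>))"

lemma visit_holds_mono:
  assumes "visit_holds W ms y t" "set ms \<subseteq> set ms'" "\<And>\<theta>. W y \<theta> \<Longrightarrow> W' y \<theta>"
  shows "visit_holds W' ms' y t"
  using assms unfolding visit_holds_def by (meson subsetD)

text \<open>A rounded arrival is never later than the true one, hence at most the next rounded
  departure, and holdover arcs bridge the gap. The last disjunct about holdover arcs concerns the
  first visit, at \<open>v\<close>, whose arriving move is not in \<open>ms\<close>; the induction
  turns it into \<open>visit_holds\<close> once that move is prepended.\<close>

lemma trajectory_walk: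
  assumes "trajectory I v a ms z" "(v, a') \<in> S" "a' \<le> a" "arrival_time I a ms \<le> T"
  shows "\<exists>p. twalk net (v, a') p (z, T) \<and>
    (\<forall>e\<in>set p. is_movement e \<longrightarrow> (\<exists>u w d. ((u, w), d) \<in> set ms \<and>
       e = Movement (u, rd u d) (w, rd w (rd u d + transit I (u, w))))) \<and>
    (\<forall>e\<in>set p. \<not> is_movement e \<longrightarrow> (\<exists>y t. e = Holdover (y, t) (y, next_at y t) \<and>
       (y = v \<or> y \<in> snd ` fst ` set ms) \<and>
       (y = z \<or> visit_holds (waits_at I v a ms) ms y t \<or>
        y = v \<and> a' \<le> t \<and> (\<exists>d. next_at y t \<le> d \<and> (\<forall>\<theta>. a \<le> \<theta> \<longrightarrow> \<theta> < d \<longrightarrow> waits_at I v a ms y \<theta>)))))"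
    (is "\<exists>p. ?P v a a' ms p")
  using assms
proof (induction ms arbitrary: v a a')
  case Nil
  then have "(v, T) \<in> S" "a' \<le> T" "v = z" using S_iff_bounds lower by auto
  then obtain p where p: "twalk net (v, a') p (v, T)"
    "\<forall>e\<in>set p. \<exists>t. e = Holdover (v, t) (v, next_at v t) \<and> a' \<le> t \<and> next_at v t \<le> T"
    using holdover_walk[of v a' T] Nil.prems by auto
  then have "?P v a a' [] p" using \<open>v = z\<close> by fastforce
  then show ?case by blast
next
  case (Cons m ms)
  obtain w d where m: "m = ((v, w), d)" using Cons.prems(1) by (cases m) auto
  let ?\<tau> = "transit I (v, w)"
  have arc: "(v, w) \<in> arcs I" and ad: "a \<le> d" and tail: "trajectory I w (d + ?\<tau>) ms z"
    and arr: "arrival_time I (d + ?\<tau>) ms \<le> T"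
    using Cons.prems m by auto
  let ?r = "rd v d" and ?c = "rd w (rd v d + ?\<tau>)"
  have v: "v \<in> nodes I" "w \<in> nodes I" using arc instance_facts by auto
  have r: "(v, ?r) \<in> S" "?r \<le> d" using rd_mem v by auto
  \<comment> \<open>This restores the invariant that the rounded start is no later than the true
    start.\<close>
  have c: "(w, ?c) \<in> S" "?c \<le> d + ?\<tau>" using rd_mem[OF v(2), of "?r + ?\<tau>"] r by auto
  have "a' \<le> ?r" using Cons.prems(2,3) ad by (intro rd_ge) auto
  then obtain p1 where p1: "twalk net (v, a') p1 (v, ?r)"
    "\<forall>e\<in>set p1. \<exists>t. e = Holdover (v, t) (v, next_at v t) \<and> a' \<le> t \<and> next_at v t \<le> ?r"
    using holdover_walk[OF Cons.prems(2) r(1)] by auto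
  obtain p2 where p2: "?P w (d + ?\<tau>) ?c ms p2"
    using Cons.IH[OF tail c arr] by blast
  let ?e = "Movement (v, ?r) (w, ?c)"
  let ?W = "waits_at I v a (m # ms)" and ?W2 = "waits_at I w (d + ?\<tau>) ms"
  have W2: "?W y \<theta>" if "?W2 y \<theta>" for y \<theta> using that m by simp
  have "twalk net (v, a') (p1 @ ?e # p2) (z, T)"
    using p1(1) p2 part_movesI[OF r(1) arc] by (auto simp: twalk_append)
  moreover have "\<exists>u w d. ((u, w), d) \<in> set (m # ms) \<and>
       e = Movement (u, rd u d) (w, rd w (rd u d + transit I (u, w)))"
    if e: "e \<in> set (p1 @ ?e # p2)" "is_movement e" for e
  proof -
    from e p1(2) consider "e = ?e" | "e \<in> set p2" by fastforce
    then show ?thesis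
    proof cases
      case 1
      then show ?thesis using m by auto
    next
      case 2
      then obtain u w d where "((u, w), d) \<in> set ms"
        "e = Movement (u, rd u d) (w, rd w (rd u d + transit I (u, w)))" using p2 e(2) by blast
      then show ?thesis by auto
    qed
  qed
  moreover have "\<exists>y t. e = Holdover (y, t) (y, next_at y t) \<and>
       (y = v \<or> y \<in> snd ` fst ` set (m # ms)) \<and>
       (y = z \<or> visit_holds ?W (m # ms) y t \<or>
        y = v \<and> a' \<le> t \<and> (\<exists>d. next_at y t \<le> d \<and> (\<forall>\<theta>. a \<le> \<theta> \<longrightarrow> \<theta> < d \<longrightarrow> ?W y \<theta>)))"
    if e: "e \<in> set (p1 @ ?e # p2)" "\<not> is_movement e" for e
  proof -
    from e have "e \<in> set p1 \<or> e \<in> set p2" by auto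
    then show ?thesis
    proof
      assume "e \<in> set p1"
      then obtain t where "e = Holdover (v, t) (v, next_at v t)" "a' \<le> t" "next_at v t \<le> d"
        using p1(2) r(2) by fastforce
      then show ?thesis using m by (intro exI[of _ v] exI[of _ t]) auto
    next
      assume "e \<in> set p2"
      then obtain y t where yt: "e = Holdover (y, t) (y, next_at y t)" "y = w \<or> y \<in> snd ` fst ` set ms"
        and why: "y = z \<or> visit_holds ?W2 ms y t \<or>
        y = w \<and> ?c \<le> t \<and> (\<exists>d'. next_at y t \<le> d' \<and> (\<forall>\<theta>. d + ?\<tau> \<le> \<theta> \<longrightarrow> \<theta> < d' \<longrightarrow> ?W2 y \<theta>))"
        using p2 e(2) by blast
      have "y = z \<or> visit_holds ?W (m # ms) y t"
        using why
      proof (elim disjE)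
        assume "visit_holds ?W2 ms y t"
        then have "visit_holds ?W (m # ms) y t" by (rule visit_holds_mono) (use W2 in auto)
        then show ?thesis ..
      next
        assume "y = w \<and> ?c \<le> t \<and> (\<exists>d'. next_at y t \<le> d' \<and> (\<forall>\<theta>. d + ?\<tau> \<le> \<theta> \<longrightarrow> \<theta> < d' \<longrightarrow> ?W2 y \<theta>))"
        then obtain d' where "y = w" "?c \<le> t" "next_at y t \<le> d'"
          "\<forall>\<theta>. d + ?\<tau> \<le> \<theta> \<longrightarrow> \<theta> < d' \<longrightarrow> ?W y \<theta>" using W2 by blast
        \<comment> \<open>The prepended move is the arrival at \<open>w\<close> that was missing in
          the tail.\<close>
        then have "visit_holds ?W (m # ms) y t" unfolding visit_holds_def
          using m by (intro exI[of _ v] exI[of _ d] exI[of _ d']) auto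
        then show ?thesis ..
      qed simp
      then show ?thesis using yt m by (intro exI[of _ y] exI[of _ t]) auto
    qed
  qed
  ultimately have "?P v a a' (m # ms) (p1 @ ?e # p2)" by blast
  then show ?case by blast
qed

end

lemma sum_of_bool_card:
  "finite A \<Longrightarrow> (\<Sum>a\<in>A. of_bool (P a)) = card {a \<in> A. P a}"
  by (simp add: of_bool_def sum.If_cases Int_def)

text \<open>Meant for the objective sum over the arcs entering a destination, of which a rounded
  walk uses at most one.\<close>

lemma sum_single_le:
  fixes c :: "'a \<Rightarrow> nat"
  assumes "finite A" "\<And>e. e \<in> A \<Longrightarrow> e \<in> B \<Longrightarrow> e = e\<^sub>0 \<and> c e \<le> M"
  shows "(\<Sum>e\<in>A. c e * of_bool (e \<in> B)) \<le> M"
proof -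
  have "(\<Sum>e\<in>A. c e * of_bool (e \<in> B)) = (\<Sum>e\<in>A \<inter> B. c e)"
    using assms(1) by (simp add: of_bool_def if_distrib sum.If_cases cong: if_cong)
  also have "\<dots> \<le> M"
  proof (cases "A \<inter> B = {}")
    case False
    then have "A \<inter> B = {e\<^sub>0}" using assms(2) by auto
    then show ?thesis using assms(2)[of e\<^sub>0] by auto
  qed simp
  finally show ?thesis .
qed

lemma card_UN_le_mult:
  assumes "finite D" "\<And>d. d \<in> D \<Longrightarrow> card (A d) \<le> c"
  shows "card (\<Union>d\<in>D. A d) \<le> c * card D"
proof -
  have "card (\<Union>d\<in>D. A d) \<le> (\<Sum>d\<in>D. card (A d))" using assms(1) by (rule card_UN_le)
  also have "\<dots> \<le> c * card D" using sum_bounded_above[of D "\<lambda>d. card (A d)" c] assms(2) by (simp add: mult.commute)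
  finally show ?thesis .
qed

section \<open>Capacities and cost of rounded routings\<close>

context partial_network
begin

text \<open>Holdovers at \<open>s\<close> and \<open>z\<close> need no justification, because a
  packet does not count towards the storage at its origin or destination. The unique movement arc
  into \<open>z\<close> keeps the objective sum from charging several arrivals.\<close>

definition represents :: "'v \<Rightarrow> 'v \<Rightarrow> 'v move list \<Rightarrow> 'v tarc list \<Rightarrow> bool" where
  "represents s z ms p \<longleftrightarrow> twalk net (s, 0) p (z, T) \<and> distinct p \<and>
    (\<forall>e\<in>set p. is_movement e \<longrightarrow> (\<exists>u w d. ((u, w), d) \<in> set ms \<and>
       e = Movement (u, rd u d) (w, rd w (rd u d + transit I (u, w))))) \<and>
    (\<exists>e\<^sub>0. \<forall>e\<in>set p. is_movement e \<longrightarrow> fst (tgt e) = z \<longrightarrow> e = e\<^sub>0) \<and>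
    (\<forall>e\<in>set p. \<not> is_movement e \<longrightarrow> (\<exists>y t. e = Holdover (y, t) (y, next_at y t) \<and>
       (y = s \<or> y \<in> snd ` fst ` set ms) \<and>
       (y = s \<or> y = z \<or> visit_holds (waits_at I s 0 ms) ms y t)))"

text \<open>Truncation yields the single arc into \<open>z\<close>, and loop erasure yields distinct
  arcs. Both only discard moves or arcs, and every clause survives passing back to the larger list
  \<open>ms\<close>.\<close>

lemma represents_exists:
  assumes traj: "trajectory I s 0 ms z" and s: "s \<in> nodes I" and arr: "arrival_time I 0 ms \<le> T"
  shows "\<exists>p. represents s z ms p"
proof -
  obtain ms' m0 where ms': "trajectory I s 0 ms' z" "set ms' \<subseteq> set ms"
    "arrival_time I 0 ms' \<le> arrival_time I 0 ms"
    "\<And>y \<theta>. waits_at I s 0 ms' y \<theta> \<Longrightarrow> waits_at I s 0 ms y \<theta>"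
    and m0: "\<And>m. m \<in> set ms' \<Longrightarrow> snd (fst m) = z \<Longrightarrow> m = m0"
    using trajectory_truncate[OF traj] by blast
  have "(s, 0) \<in> S" "arrival_time I 0 ms' \<le> T" using s lower arr ms'(3) by auto
  from trajectory_walk[OF ms'(1) this(1) _ this(2)] obtain q where q: "twalk net (s, 0) q (z, T)"
    and mov: "\<And>e. e \<in> set q \<Longrightarrow> is_movement e \<Longrightarrow> \<exists>u w d. ((u, w), d) \<in> set ms' \<and>
       e = Movement (u, rd u d) (w, rd w (rd u d + transit I (u, w)))"
    and hold: "\<And>e. e \<in> set q \<Longrightarrow> \<not> is_movement e \<Longrightarrow> \<exists>y t. e = Holdover (y, t) (y, next_at y t) \<and>
       (y = s \<or> y \<in> snd ` fst ` set ms') \<and>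
       (y = s \<or> y = z \<or> visit_holds (waits_at I s 0 ms') ms' y t)"
    by (auto simp del: split_paired_Ex) metis+
  obtain p where p: "twalk net (s, 0) p (z, T)" "distinct p" "set p \<subseteq> set q"
    using twalk_simple[OF q] .
  have "\<exists>u w d. ((u, w), d) \<in> set ms \<and> e = Movement (u, rd u d) (w, rd w (rd u d + transit I (u, w)))"
    if "e \<in> set p" "is_movement e" for e
    using mov[of e] that p(3) ms'(2) by blast
  moreover have "\<exists>e\<^sub>0. \<forall>e\<in>set p. is_movement e \<longrightarrow> fst (tgt e) = z \<longrightarrow> e = e\<^sub>0"
  proof -
    obtain u0 w0 d0 where m0': "m0 = ((u0, w0), d0)" by (metis surj_pair)
    have "e = Movement (u0, rd u0 d0) (w0, rd w0 (rd u0 d0 + transit I (u0, w0)))"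
      if e: "e \<in> set p" "is_movement e" "fst (tgt e) = z" for e
    proof -
      from e p(3) obtain u w d where "((u, w), d) \<in> set ms'"
        "e = Movement (u, rd u d) (w, rd w (rd u d + transit I (u, w)))" using mov[of e] by blast
      then show ?thesis using m0[of "((u, w), d)"] e(3) m0' by simp
    qed
    then show ?thesis by blast
  qed
  moreover have "\<exists>y t. e = Holdover (y, t) (y, next_at y t) \<and> (y = s \<or> y \<in> snd ` fst ` set ms) \<and>
       (y = s \<or> y = z \<or> visit_holds (waits_at I s 0 ms) ms y t)"
    if e: "e \<in> set p" "\<not> is_movement e" for e
  proof -
    obtain y t where yt: "e = Holdover (y, t) (y, next_at y t)" "y = s \<or> y \<in> snd ` fst ` set ms'"
      "y = s \<or> y = z \<or> visit_holds (waits_at I s 0 ms') ms' y t" using hold[of e] e p(3) by blast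
    have "visit_holds (waits_at I s 0 ms') ms' y t \<Longrightarrow> visit_holds (waits_at I s 0 ms) ms y t"
      by (rule visit_holds_mono) (use ms'(2,4) in blast)+
    then show ?thesis using yt ms'(2) by blast
  qed
  ultimately have "represents s z ms p" unfolding represents_def using p(1,2) by blast
  then show ?thesis by blast
qed

lemma represents_movement:
  assumes "represents s z ms p" "Movement (v, t) (w, t') \<in> set p"
  shows "\<exists>d. ((v, w), d) \<in> set ms \<and> t = rd v d \<and> t' = rd w (t + transit I (v, w))"
proof -
  have "\<exists>u w2 d. ((u, w2), d) \<in> set ms \<and>
      Movement (v, t) (w, t') = Movement (u, rd u d) (w2, rd w2 (rd u d + transit I (u, w2)))"
    using assms unfolding represents_def by fastforce
  then show ?thesis by auto
qed

lemma represents_holdover: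
  assumes "represents s z ms p" "Holdover (v, t) (w, t') \<in> set p"
  shows "w = v" "t' = next_at v t" "v = s \<or> v \<in> snd ` fst ` set ms"
    "v = s \<or> v = z \<or> visit_holds (waits_at I s 0 ms) ms v t"
proof -
  have "\<exists>y t2. Holdover (v, t) (w, t') = Holdover (y, t2) (y, next_at y t2) \<and>
       (y = s \<or> y \<in> snd ` fst ` set ms) \<and>
       (y = s \<or> y = z \<or> visit_holds (waits_at I s 0 ms) ms y t2)"
    using assms unfolding represents_def by fastforce
  then show "w = v" "t' = next_at v t" "v = s \<or> v \<in> snd ` fst ` set ms"
    "v = s \<or> v = z \<or> visit_holds (waits_at I s 0 ms) ms v t" by auto
qed

text \<open>The true departures rounded to \<open>t\<close> lie between \<open>t\<close> and the
  next copy of \<open>v\<close>. This window has \<open>next_gap\<close> integer times, each with at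
  most \<open>capacity\<close> departures.\<close>

lemma move_capacity:
  assumes R: "feasible_routing I R" "\<And>k. k \<in> packets I \<Longrightarrow> arrival_time I 0 (R k) \<le> T"
    and p: "\<And>k. k \<in> packets I \<Longrightarrow> represents (origin I k) (dest I k) (R k) (p k)"
    and e: "e \<in> part_moves I S"
  shows "card {k \<in> packets I. e \<in> set (p k)} \<le> part_move_cap I S e"
proof -
  obtain v t w t' where e': "e = Movement (v, t) (w, t')" and arc: "(v, w) \<in> arcs I"
    using e unfolding part_moves_def by auto
  let ?A = "\<lambda>d. {k \<in> packets I. ((v, w), d) \<in> set (R k)}"
  have "{k \<in> packets I. e \<in> set (p k)} \<subseteq> (\<Union>d\<in>{t..<next_at v t}. ?A d)"
  proof
    fix k assume "k \<in> {k \<in> packets I. e \<in> set (p k)}"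
    then have k: "k \<in> packets I" "e \<in> set (p k)" by auto
    obtain d where d: "((v, w), d) \<in> set (R k)" "t = rd v d"
      using represents_movement[OF p[OF k(1)], of v t w t'] k(2) e' by auto
    have traj: "trajectory I (origin I k) 0 (R k) (dest I k)"
      using R(1) k(1) unfolding feasible_routing_def by auto
    \<comment> \<open>A positive transit time puts the departure strictly before \<open>T\<close>,
      where \<open>next_at\<close> is a genuine next time.\<close>
    have "d < T" using move_le_arrival_time[OF traj d(1)] R(2)[OF k(1)] instance_facts(6)[OF arc] by auto
    then have "d \<in> {t..<next_at v t}"
      using less_next_rd[of v d] rd_mem[of v d] instance_facts(4)[OF arc] d(2) by auto
    then show "k \<in> (\<Union>d\<in>{t..<next_at v t}. ?A d)" using k d by blast
  qed
  then have "card {k \<in> packets I. e \<in> set (p k)} \<le> card (\<Union>d\<in>{t..<next_at v t}. ?A d)"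
    using instance_facts(2) by (intro card_mono) auto
  also have "\<dots> \<le> capacity I (v, w) * card {t..<next_at v t}"
    using R(1) arc unfolding feasible_routing_def by (intro card_UN_le_mult) auto
  also have "\<dots> = part_move_cap I S e"
    unfolding part_move_cap_def next_gap_def e' base_arc_def by simp
  finally show ?thesis .
qed

lemma finite_full_moves: "finite (full_moves I T')"
proof -
  have "full_moves I T' \<subseteq> (\<lambda>((v, t), w). Movement (v, t) (w, t + transit I (v, w))) ` ((nodes I \<times> {0..T'}) \<times> nodes I)"
  proof
    fix e assume "e \<in> full_moves I T'"
    then obtain v w t where "e = Movement (v, t) (w, t + transit I (v, w))"
      "(v, w) \<in> arcs I" "t + transit I (v, w) \<le> T'" unfolding full_moves_def by blast
    then show "e \<in> (\<lambda>((v, t), w). Movement (v, t) (w, t + transit I (v, w))) ` ((nodes I \<times> {0..T'}) \<times> nodes I)"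
      using instance_facts(4,5) by (intro image_eqI[of _ _ "((v, t), w)"]) auto
  qed
  then show ?thesis using instance_facts(1) by (meson finite_SigmaI finite_atLeastAtMost finite_imageI finite_subset)
qed

lemma finite_full_arcs: "finite (full_moves I T' \<union> full_holds I T')"
proof -
  have "full_holds I T' \<subseteq> (\<lambda>(v, t). Holdover (v, t) (v, t + 1)) ` (nodes I \<times> {0..T'})"
    unfolding full_holds_def by force
  then have "finite (full_holds I T')"
    using instance_facts(1) by (meson finite_SigmaI finite_atLeastAtMost finite_imageI finite_subset)
  then show ?thesis using finite_full_moves by simp
qed

lemma move_tails_part: "(u, r) \<in> S \<Longrightarrow> (u, v) \<in> arcs I \<Longrightarrow> rd v (r + transit I (u, v)) = t \<Longrightarrow>
    (u, r) \<in> move_tails (part_moves I S) (v, t)"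
  unfolding move_tails_def using part_movesI[of u r v] by (intro image_eqI) auto

lemma move_tails_full: "(u, v) \<in> arcs I \<Longrightarrow> r + transit I (u, v) = t \<Longrightarrow> t \<le> T' \<Longrightarrow>
    (u, r) \<in> move_tails (full_moves I T') (v, t)"
  unfolding move_tails_def full_moves_def
  by (intro image_eqI[of _ _ "Movement (u, r) (v, t)"]) auto

text \<open>
  A packet that uses the arc and truly arrives before the next copy of \<open>v\<close> waits at \<open>v\<close> during the
  last unit of time of the arc; every other packet left some tail \<open>z\<close> of an arc entering \<open>(v, t)\<close>
  strictly between \<open>z\<close> and the next copy of its node.
\<close>

lemma hold_capacity:
  assumes R: "feasible_routing I R" "\<And>k. k \<in> packets I \<Longrightarrow> arrival_time I 0 (R k) \<le> T"
    and p: "\<And>k. k \<in> packets I \<Longrightarrow> represents (origin I k) (dest I k) (R k) (p k)"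
    and e: "e \<in> part_holds T S"
  shows "card {k \<in> packets_at I (fst (src e)). e \<in> set (p k)} \<le> part_hold_cap I T S (src e)"
proof -
  obtain v t where e': "e = Holdover (v, t) (v, next_at v t)" and vt: "(v, t) \<in> S" "t < T"
    using e unfolding part_holds_def by auto
  have v: "v \<in> nodes I" using S_iff_bounds[OF vt(1)] by simp
  let ?n = "next_at v t"
  let ?Z = "move_tails (full_moves I T) (v, t) \<union> move_tails (part_moves I S) (v, t)"
  let ?B = "{k \<in> packets_at I v. waits_at I (origin I k) 0 (R k) v (?n - 1)}"
  let ?A = "\<lambda>z d. {k \<in> packets I. ((fst z, v), d) \<in> set (R k)}"
  let ?D = "\<lambda>z. {snd z<..<next_time S z}"
  have finZ: "finite ?Z" unfolding move_tails_def using finite_full_moves finite_net(1) by auto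
  have arcZ: "(fst z, v) \<in> arcs I" if "z \<in> ?Z" for z
    using that unfolding move_tails_def full_moves_def part_moves_def by auto
  have "{k \<in> packets_at I v. e \<in> set (p k)} \<subseteq> ?B \<union> (\<Union>z\<in>?Z. \<Union>d\<in>?D z. ?A z d)"
  proof
    fix k assume "k \<in> {k \<in> packets_at I v. e \<in> set (p k)}"
    then have kv: "k \<in> packets_at I v" and kp: "e \<in> set (p k)" by auto
    then have k: "k \<in> packets I" "v \<noteq> origin I k" "v \<noteq> dest I k" unfolding packets_at_def by auto
    have "visit_holds (waits_at I (origin I k) 0 (R k)) (R k) v t"
      using represents_holdover(4)[OF p[OF k(1)], of v t v ?n] kp e' k by auto
    then obtain u d0 d where d0: "((u, v), d0) \<in> set (R k)" and d: "?n \<le> d"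
      and early: "rd v (rd u d0 + transit I (u, v)) \<le> t"
      and waits: "\<And>\<theta>. d0 + transit I (u, v) \<le> \<theta> \<Longrightarrow> \<theta> < d \<Longrightarrow> waits_at I (origin I k) 0 (R k) v \<theta>"
      unfolding visit_holds_def by blast
    let ?\<tau> = "transit I (u, v)"
    have traj: "trajectory I (origin I k) 0 (R k) (dest I k)"
      using R(1) k(1) unfolding feasible_routing_def by auto
    have arc: "(u, v) \<in> arcs I" and arr: "d0 + ?\<tau> \<le> T"
      using move_le_arrival_time[OF traj d0] R(2)[OF k(1)] by auto
    have d0T: "d0 < T" using arr instance_facts(6)[OF arc] by simp
    have u: "u \<in> nodes I" using instance_facts(4)[OF arc] .
    note nxt = next_mem[OF v vt(2)]
    show "k \<in> ?B \<union> (\<Union>z\<in>?Z. \<Union>d\<in>?D z. ?A z d)"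
    proof (cases "d0 + ?\<tau> < ?n")
      case True
      then have "waits_at I (origin I k) 0 (R k) v (?n - 1)" using d by (intro waits) auto
      then show ?thesis using kv by auto
    next
      case late: False
      have r: "(u, rd u d0) \<in> S" "rd u d0 \<le> d0" "d0 < next_at u (rd u d0)"
        using rd_mem[OF u] less_next_rd[OF u d0T] by auto
      have lt: "rd u d0 + ?\<tau> < ?n"
      proof (rule ccontr)
        assume "\<not> rd u d0 + ?\<tau> < ?n"
        then have "?n \<le> rd v (rd u d0 + ?\<tau>)" using nxt by (intro rd_ge) auto
        then show False using early nxt by linarith
      qed
      \<comment> \<open>If the rounded departure arrives at \<open>t\<close> or later, its own tail
        in \<open>D\<^sub>S\<close> serves, and lateness makes the rounding strict. If it arrives
        before \<open>t\<close>, the tail of the full arc that arrives exactly at \<open>t\<close>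
        serves. That tail lies strictly between copies of \<open>u\<close>, which is why the slack
        ranges over the tails of both networks.\<close>
      have "\<exists>z\<in>?Z. fst z = u \<and> d0 \<in> ?D z"
      proof (cases "t \<le> rd u d0 + ?\<tau>")
        case True
        then have "rd v (rd u d0 + ?\<tau>) = t" using rd_ge[OF vt(1) True] early by simp
        then have "(u, rd u d0) \<in> ?Z" using move_tails_part[OF r(1) arc] by blast
        moreover have "rd u d0 \<noteq> d0" using lt late by auto
        ultimately show ?thesis using r by (intro bexI[of _ "(u, rd u d0)"]) auto
      next
        case False
        let ?r = "t - ?\<tau>"
        have r2: "?r + ?\<tau> = t" "rd u d0 < ?r" "?r < d0" using False late nxt by auto
        then have "(u, ?r) \<in> ?Z" using move_tails_full[OF arc r2(1)] vt(2) by simp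
        moreover have "d0 < next_at u ?r"
        proof (rule ccontr)
          assume "\<not> d0 < next_at u ?r"
          moreover have "(u, next_at u ?r) \<in> S" "?r < next_at u ?r"
            using next_mem[OF u, of ?r] vt(2) by auto
          ultimately show False using rd_ge[of u "next_at u ?r" d0] r2 by linarith
        qed
        ultimately show ?thesis using r2 by (intro bexI[of _ "(u, ?r)"]) auto
      qed
      then obtain z where "z \<in> ?Z" "fst z = u" "d0 \<in> ?D z" by blast
      then have "k \<in> (\<Union>z\<in>?Z. \<Union>d\<in>?D z. ?A z d)" using k(1) d0 by blast
      then show ?thesis by blast
    qed
  qed
  then have "card {k \<in> packets_at I v. e \<in> set (p k)} \<le> card (?B \<union> (\<Union>z\<in>?Z. \<Union>d\<in>?D z. ?A z d))"
    using instance_facts(2,3) finZ by (intro card_mono) auto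
  also have "\<dots> \<le> card ?B + card (\<Union>z\<in>?Z. \<Union>d\<in>?D z. ?A z d)" by (rule card_Un_le)
  also have "card (\<Union>z\<in>?Z. \<Union>d\<in>?D z. ?A z d) \<le> (\<Sum>z\<in>?Z. card (\<Union>d\<in>?D z. ?A z d))"
    by (rule card_UN_le[OF finZ])
  also have "\<dots> \<le> (\<Sum>z\<in>?Z. capacity I (fst z, fst (v, t)) * (next_gap S z - 1))"
  proof (rule sum_mono)
    fix z assume "z \<in> ?Z"
    then have "card (\<Union>d\<in>?D z. ?A z d) \<le> capacity I (fst z, v) * card (?D z)"
      using R(1) arcZ unfolding feasible_routing_def by (intro card_UN_le_mult) auto
    then show "card (\<Union>d\<in>?D z. ?A z d) \<le> capacity I (fst z, fst (v, t)) * (next_gap S z - 1)"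
      unfolding next_gap_def by simp
  qed
  also have "card ?B \<le> storage I v" using R(1) v unfolding feasible_routing_def by auto
  finally have "card {k \<in> packets_at I v. e \<in> set (p k)} \<le> storage I v + part_hold_slack I T S (v, t)"
    unfolding part_hold_slack_def by simp
  then show ?thesis unfolding part_hold_cap_def e' by (auto split: if_splits)
qed

lemma relaxation:
  assumes R: "feasible_routing I R" and M: "makespan I R \<le> M" "M \<le> T"
  shows "\<exists>x. upr_DS_feasible I T S x (real M)"
proof -
  have arr: "arrival_time I 0 (R k) \<le> M" if "k \<in> packets I" for k
    using that M(1) makespan_le_iff[OF instance_facts(2)] by blast
  then have arrT: "arrival_time I 0 (R k) \<le> T" if "k \<in> packets I" for k
    using that M(2) by fastforce
  have traj: "trajectory I (origin I k) 0 (R k) (dest I k)" if "k \<in> packets I" for k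
    using R that unfolding feasible_routing_def by auto
  have "\<forall>k\<in>packets I. \<exists>p. represents (origin I k) (dest I k) (R k) p"
    using represents_exists traj instance_facts(7) arrT by blast
  then obtain p where p: "\<And>k. k \<in> packets I \<Longrightarrow> represents (origin I k) (dest I k) (R k) (p k)"
    by metis
  define x where "x k e = (of_bool (e \<in> set (p k)) :: nat)" for k e
  have walk: "twalk net (origin I k, 0) (p k) (dest I k, T)" "distinct (p k)" if "k \<in> packets I" for k
    using p[OF that] unfolding represents_def by auto
  \<comment> \<open>The charge starts from the rounded departure, so it is at most the true arrival
    time.\<close>
  have time: "true_arrival I e \<le> M" if k: "k \<in> packets I" and e: "e \<in> part_moves I S" "e \<in> set (p k)" for k e
  proof -
    obtain v t w t' where e': "e = Movement (v, t) (w, t')"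
      using e(1) unfolding part_moves_def by auto
    obtain d where d: "((v, w), d) \<in> set (R k)" "t = rd v d"
      using represents_movement[OF p[OF k], of v t w t'] e(2) e' by auto
    have "(v, w) \<in> arcs I" "d + transit I (v, w) \<le> M"
      using move_le_arrival_time[OF traj[OF k] d(1)] arr[OF k] by auto
    then show ?thesis using rd_mem[of v d] instance_facts(4) d(2)
      unfolding true_arrival_def e' base_arc_def by fastforce
  qed
  have "binary_on net (x k)" if "k \<in> packets I" for k
    unfolding binary_on_def x_def using twalk_subset[OF walk(1)[OF that]] by auto
  moreover have "true_arrival I e * x k e \<le> M" if "k \<in> packets I" "e \<in> part_moves I S" for k e
    using time[OF that] unfolding x_def by auto
  moreover have "(\<Sum>e | e \<in> part_moves I S \<and> fst (tgt e) = dest I k. true_arrival I e * x k e) \<le> M"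
    if k: "k \<in> packets I" for k
  proof -
    obtain e0 where "\<And>e. e \<in> set (p k) \<Longrightarrow> is_movement e \<Longrightarrow> fst (tgt e) = dest I k \<Longrightarrow> e = e0"
      using p[OF k] unfolding represents_def by blast
    then show ?thesis unfolding x_def
      using finite_net(1) time[OF k] is_movement_part(1) by (intro sum_single_le[where e\<^sub>0 = e0]) auto
  qed
  moreover have "unit_flow S net (origin I k, 0) (dest I k, T) (x k)" if "k \<in> packets I" for k
    unfolding x_def using walk[OF that] by (intro unit_flow_walk finite_net)
  moreover have "(\<Sum>k\<in>packets I. x k e) \<le> part_move_cap I S e" if "e \<in> part_moves I S" for e
    using move_capacity[OF R arrT p that] unfolding x_def sum_of_bool_card[OF instance_facts(2)] .
  moreover have "(\<Sum>k\<in>packets_at I (fst (src e)). x k e) \<le> part_hold_cap I T S (src e)"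
    if "e \<in> part_holds T S" for e
    using hold_capacity[OF R arrT p that] unfolding x_def sum_of_bool_card[OF instance_facts(3)] .
  ultimately have "upr_DS_feasible I T S x (real M)"
    unfolding upr_DS_feasible_def of_nat_le_iff by blast
  then show ?thesis by blast
qed

end

section \<open>The fully expanded network as a partial network\<close>

lemma partial_network_full:
  "upr_instance I \<Longrightarrow> partial_network I T (full_nodes I T)"
  unfolding partial_network_def full_nodes_def by auto

text \<open>Rounding is the identity on \<open>full_nodes I T'\<close>, so representing walks depart
  and arrive at the true times. All their movement arcs copy arcs of \<open>P k\<close>, and they
  wait only at the origin or at heads of such arcs, as the restriction to \<open>path_arcs\<close>
  demands.\<close>

lemma routing_FP_feasible:
  assumes inst: "upr_instance I" and R: "feasible_routing I R"
    and P: "\<And>k. k \<in> packets I \<Longrightarrow> fst ` set (R k) \<subseteq> set (P k)"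
    and arr: "\<And>k. k \<in> packets I \<Longrightarrow> real (arrival_time I 0 (R k)) \<le> Tbar"
    and Tbar: "0 \<le> Tbar" "Tbar \<le> real T'"
  shows "\<exists>x. upr_FP_feasible I T' P x Tbar"
proof -
  interpret partial_network I T' "full_nodes I T'" by (rule partial_network_full[OF inst])
  \<comment> \<open>The bound \<open>Tbar\<close> may be fractional, but arrival times are
    not.\<close>
  define M where "M = nat \<lfloor>Tbar\<rfloor>"
  have M: "real M \<le> Tbar" "M \<le> T'" using Tbar unfolding M_def by linarith+
  have arrM: "arrival_time I 0 (R k) \<le> M" if "k \<in> packets I" for k
    using arr[OF that] Tbar unfolding M_def by linarith
  then have arrT: "arrival_time I 0 (R k) \<le> T'" if "k \<in> packets I" for k
    using that M(2) by fastforce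
  have rd: "rd v \<theta> = \<theta>" if "v \<in> nodes I" "\<theta> \<le> T'" for v \<theta>
    using that rd_exact[of v \<theta>] unfolding full_nodes_def by auto
  have nxt: "next_at v t = t + 1" if "v \<in> nodes I" "t < T'" for v t
    using that next_Suc[of v t] unfolding full_nodes_def by auto
  have traj: "trajectory I (origin I k) 0 (R k) (dest I k)" if "k \<in> packets I" for k
    using R that unfolding feasible_routing_def by auto
  have "\<forall>k\<in>packets I. \<exists>p. represents (origin I k) (dest I k) (R k) p"
    using represents_exists traj instance_facts(7) arrT by blast
  then obtain p where p: "\<And>k. k \<in> packets I \<Longrightarrow> represents (origin I k) (dest I k) (R k) (p k)"
    by metis
  define x where "x k e = (of_bool (e \<in> set (p k)) :: nat)" for k e
  have walk: "twalk net (origin I k, 0) (p k) (dest I k, T')" "distinct (p k)" if "k \<in> packets I" for k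
    using p[OF that] unfolding represents_def by auto
  have mov: "\<exists>v w d. e = Movement (v, d) (w, d + transit I (v, w)) \<and> ((v, w), d) \<in> set (R k) \<and>
      (v, w) \<in> arcs I \<and> d + transit I (v, w) \<le> M"
    if k: "k \<in> packets I" and e: "e \<in> set (p k)" "is_movement e" for k e
  proof -
    obtain v t w t' where e': "e = Movement (v, t) (w, t')" using e(2) by (cases e) auto
    obtain d where d: "((v, w), d) \<in> set (R k)" "t = rd v d" "t' = rd w (t + transit I (v, w))"
      using represents_movement[OF p[OF k], of v t w t'] e(1) e' by auto
    have a: "(v, w) \<in> arcs I" "d + transit I (v, w) \<le> M"
      using move_le_arrival_time[OF traj[OF k] d(1)] arrM[OF k] by auto
    then show ?thesis using rd[of v d] rd[of w "d + transit I (v, w)"] instance_facts(4,5)[OF a(1)] M(2) d e'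
      by auto
  qed
  have hold: "\<exists>v t. e = Holdover (v, t) (v, t + 1) \<and> v \<in> nodes I \<and> t < T'"
    if k: "k \<in> packets I" and e: "e \<in> set (p k)" "\<not> is_movement e" for k e
  proof -
    have "e \<in> net" using twalk_subset[OF walk(1)[OF k]] e(1) by blast
    then have "e \<in> part_holds T' (full_nodes I T')" using e(2) is_movement_part(1) by blast
    then show ?thesis unfolding part_holds_def using nxt S_iff_bounds by fastforce
  qed
  have in_path: "set (p k) \<subseteq> path_arcs I T' k (P k)" if k: "k \<in> packets I" for k
  proof
    fix e assume e: "e \<in> set (p k)"
    show "e \<in> path_arcs I T' k (P k)"
    proof (cases "is_movement e")
      case True
      then obtain v w d where e': "e = Movement (v, d) (w, d + transit I (v, w))" "((v, w), d) \<in> set (R k)"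
        "(v, w) \<in> arcs I" "d + transit I (v, w) \<le> M" using mov[OF k e] by blast
      then have "e \<in> full_moves I T'" unfolding full_moves_def using M(2) by auto
      moreover have "base_arc e \<in> set (P k)" using e' P[OF k] unfolding base_arc_def by force
      ultimately show ?thesis unfolding path_arcs_def by auto
    next
      case False
      then obtain v t where e': "e = Holdover (v, t) (v, t + 1)" "v \<in> nodes I" "t < T'"
        using hold[OF k e] by blast
      have "v = origin I k \<or> v \<in> snd ` fst ` set (R k)"
        using represents_holdover(3)[OF p[OF k], of v t v "t + 1"] e e' by auto
      then have "v \<in> path_nodes I k (P k)" using P[OF k] unfolding path_nodes_def by blast
      then show ?thesis using e' unfolding path_arcs_def full_holds_def by auto
    qed
  qed
  have sub: "set (p k) \<subseteq> full_moves I T' \<union> full_holds I T'" if "k \<in> packets I" for k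
    using in_path[OF that] unfolding path_arcs_def by blast
  have fmov: "is_movement e" if "e \<in> full_moves I T'" for e
    using that unfolding full_moves_def by auto
  have time: "snd (tgt e) \<le> M" if k: "k \<in> packets I" and e: "e \<in> full_moves I T'" "e \<in> set (p k)" for k e
    using mov[OF k e(2) fmov[OF e(1)]] by auto
  have le: "real n \<le> Tbar" if "n \<le> M" for n
    using that M(1) by linarith
  have "binary_on (path_arcs I T' k (P k)) (x k)" if "k \<in> packets I" for k
    unfolding binary_on_def x_def using in_path[OF that] by auto
  moreover have "real (snd (tgt e) * x k e) \<le> Tbar" if "k \<in> packets I" "e \<in> full_moves I T'" for k e
    using time[OF that] by (intro le) (auto simp: x_def)
  moreover have "real (\<Sum>e | e \<in> full_moves I T' \<and> fst (tgt e) = dest I k. snd (tgt e) * x k e) \<le> Tbar"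
    if k: "k \<in> packets I" for k
  proof -
    obtain e0 where "\<And>e. e \<in> set (p k) \<Longrightarrow> is_movement e \<Longrightarrow> fst (tgt e) = dest I k \<Longrightarrow> e = e0"
      using p[OF k] unfolding represents_def by blast
    then show ?thesis unfolding x_def
      using finite_full_moves time[OF k] fmov by (intro le sum_single_le[where e\<^sub>0 = e0]) auto
  qed
  moreover have "unit_flow (full_nodes I T') (full_moves I T' \<union> full_holds I T')
      (origin I k, 0) (dest I k, T') (x k)" if "k \<in> packets I" for k
    unfolding x_def using twalk_mono[OF walk(1) sub] walk(2) that by (intro unit_flow_walk finite_full_arcs) auto
  moreover have "(\<Sum>k\<in>packets I. x k e) \<le> capacity I (base_arc e)" if e: "e \<in> full_moves I T'" for e
  proof -
    obtain v w t where e': "e = Movement (v, t) (w, t + transit I (v, w))" "(v, w) \<in> arcs I"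
      using e unfolding full_moves_def by auto
    have "{k \<in> packets I. e \<in> set (p k)} \<subseteq> {k \<in> packets I. ((v, w), t) \<in> set (R k)}"
      using mov e' by fastforce
    then have "card {k \<in> packets I. e \<in> set (p k)} \<le> card {k \<in> packets I. ((v, w), t) \<in> set (R k)}"
      using instance_facts(2) by (intro card_mono) auto
    also have "\<dots> \<le> capacity I (base_arc e)"
      using R e' unfolding feasible_routing_def base_arc_def by auto
    finally show ?thesis unfolding x_def sum_of_bool_card[OF instance_facts(2)] .
  qed
  moreover have "(\<Sum>k\<in>packets_at I (fst (src e)). x k e) \<le> storage I (fst (src e))"
    if e: "e \<in> full_holds I T'" for e
  proof -
    obtain v t where e': "e = Holdover (v, t) (v, t + 1)" "v \<in> nodes I" "t < T'"
      using e unfolding full_holds_def by auto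
    have "{k \<in> packets_at I v. e \<in> set (p k)} \<subseteq> {k \<in> packets_at I v. waits_at I (origin I k) 0 (R k) v t}"
    proof
      fix k assume "k \<in> {k \<in> packets_at I v. e \<in> set (p k)}"
      then have kv: "k \<in> packets_at I v" and kp: "e \<in> set (p k)" by auto
      then have k: "k \<in> packets I" "v \<noteq> origin I k" "v \<noteq> dest I k" unfolding packets_at_def by auto
      have "visit_holds (waits_at I (origin I k) 0 (R k)) (R k) v t"
        using represents_holdover(4)[OF p[OF k(1)], of v t v "t + 1"] kp e' k by auto
      then obtain u d0 d where d0: "((u, v), d0) \<in> set (R k)" and d: "next_at v t \<le> d"
        and early: "rd v (rd u d0 + transit I (u, v)) \<le> t"
        and waits: "\<And>\<theta>. d0 + transit I (u, v) \<le> \<theta> \<Longrightarrow> \<theta> < d \<Longrightarrow> waits_at I (origin I k) 0 (R k) v \<theta>"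
        unfolding visit_holds_def by blast
      have a: "(u, v) \<in> arcs I" "d0 + transit I (u, v) \<le> T'"
        using move_le_arrival_time[OF traj[OF k(1)] d0] arrT[OF k(1)] by auto
      \<comment> \<open>Rounded and true arrival coincide, so each later holdover unit up to the
        departure is a real wait.\<close>
      then have "d0 + transit I (u, v) \<le> t"
        using early rd[of u d0] rd[of v "d0 + transit I (u, v)"] instance_facts(4,5)[OF a(1)] by auto
      then have "waits_at I (origin I k) 0 (R k) v t" using d nxt[OF e'(2,3)] by (intro waits) auto
      then show "k \<in> {k \<in> packets_at I v. waits_at I (origin I k) 0 (R k) v t}" using kv by simp
    qed
    then have "card {k \<in> packets_at I v. e \<in> set (p k)} \<le> card {k \<in> packets_at I v. waits_at I (origin I k) 0 (R k) v t}"
      using instance_facts(3) by (intro card_mono) auto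
    also have "\<dots> \<le> storage I v" using R e' unfolding feasible_routing_def by auto
    finally show ?thesis unfolding x_def sum_of_bool_card[OF instance_facts(3)] e' by simp
  qed
  ultimately have "upr_FP_feasible I T' P x Tbar" unfolding upr_FP_feasible_def by blast
  then show ?thesis by blast
qed

section \<open>Optimal solutions\<close>

text \<open>All values bounded by the objective are natural numbers, so rounding it down keeps feasibility.\<close>

lemma least_natural_value:
  assumes "F x U" and floor: "\<And>y V. F y V \<Longrightarrow> 0 \<le> V \<and> F y (real (nat \<lfloor>V\<rfloor>))"
  shows "\<exists>x n. F x (real n) \<and> (\<forall>y V. F y V \<longrightarrow> real n \<le> V)"
proof -
  define n where "n = (LEAST n. \<exists>x. F x (real n))"
  have "\<exists>n x. F x (real n)" using assms by blast
  then have "\<exists>x. F x (real n)" unfolding n_def by (rule LeastI_ex)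
  moreover have "real n \<le> V" if V: "F y V" for y V
  proof -
    have "n \<le> nat \<lfloor>V\<rfloor>" unfolding n_def using floor[OF V] by (intro Least_le) blast
    then show ?thesis using floor[OF V] by linarith
  qed
  ultimately show ?thesis by blast
qed

text \<open>The destination constraint of any packet bounds the objective below, even if its sum is
  empty. With no packets every real value would be feasible and no optimum would exist.\<close>

lemma DS_feasible_nonneg:
  assumes "upr_DS_feasible I T S x U" "k \<in> packets I"
  shows "0 \<le> U"
proof -
  have "real (\<Sum>e | e \<in> part_moves I S \<and> fst (tgt e) = dest I k. true_arrival I e * x k e) \<le> U"
    using assms unfolding upr_DS_feasible_def by blast
  then show ?thesis by (rule order_trans[OF of_nat_0_le_iff])
qed

lemma DS_optimal_exists:
  assumes "upr_DS_feasible I T S x U" "k \<in> packets I"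
  shows "\<exists>x U. upr_DS_optimal I T S x U"
proof -
  have "0 \<le> V \<and> upr_DS_feasible I T S y (real (nat \<lfloor>V\<rfloor>))" if V: "upr_DS_feasible I T S y V" for y V
  proof -
    have "real n \<le> real (nat \<lfloor>V\<rfloor>) \<longleftrightarrow> real n \<le> V" for n
      using DS_feasible_nonneg[OF V assms(2)] le_nat_floor[of n V] by linarith
    then show ?thesis
      using V DS_feasible_nonneg[OF V assms(2)] unfolding upr_DS_feasible_def by (simp only: simp_thms)
  qed
  from least_natural_value[where F = "upr_DS_feasible I T S", OF assms(1) this]
  show ?thesis unfolding upr_DS_optimal_def by blast
qed

lemma FP_feasible_nonneg:
  assumes "upr_FP_feasible I T' P x U" "k \<in> packets I"
  shows "0 \<le> U"
proof -
  have "real (\<Sum>e | e \<in> full_moves I T' \<and> fst (tgt e) = dest I k. snd (tgt e) * x k e) \<le> U"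
    using assms unfolding upr_FP_feasible_def by blast
  then show ?thesis by (rule order_trans[OF of_nat_0_le_iff])
qed

lemma FP_optimal_exists:
  assumes "upr_FP_feasible I T' P x U" "k \<in> packets I"
  shows "\<exists>x U. upr_FP_optimal I T' P x U"
proof -
  have "0 \<le> V \<and> upr_FP_feasible I T' P y (real (nat \<lfloor>V\<rfloor>))" if V: "upr_FP_feasible I T' P y V" for y V
  proof -
    have "real n \<le> real (nat \<lfloor>V\<rfloor>) \<longleftrightarrow> real n \<le> V" for n
      using FP_feasible_nonneg[OF V assms(2)] le_nat_floor[of n V] by linarith
    then show ?thesis
      using V FP_feasible_nonneg[OF V assms(2)] unfolding upr_FP_feasible_def by (simp only: simp_thms)
  qed
  from least_natural_value[where F = "upr_FP_feasible I T' P", OF assms(1) this]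
  show ?thesis unfolding upr_FP_optimal_def by blast
qed

lemma compute_UB_exists:
  assumes "\<And>k. k \<in> packets I \<Longrightarrow> \<exists>P. underlying_path I T S x k P" "k \<in> packets I"
  shows "\<exists>UB' res. compute_UB I T S x Th \<alpha> UB UB' res"
proof -
  obtain P where P: "\<forall>k\<in>packets I. underlying_path I T S x k (P k)" using assms(1) by metis
  show ?thesis
  proof (cases "\<exists>y U. upr_FP_feasible I (nat \<lceil>(1 + \<alpha>) * Th\<rceil>) P y U")
    case True
    then obtain y U where "upr_FP_optimal I (nat \<lceil>(1 + \<alpha>) * Th\<rceil>) P y U"
      using FP_optimal_exists assms(2) by metis
    then show ?thesis unfolding compute_UB_def Let_def using P True by metis
  next
    case False
    then show ?thesis unfolding compute_UB_def Let_def using P by metis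
  qed
qed

lemma compute_UB_nonneg:
  assumes "compute_UB I T S x Th \<alpha> UB UB' res" "k \<in> packets I" "0 \<le> UB"
  shows "0 \<le> UB'"
proof -
  obtain P where "if \<exists>y U. upr_FP_feasible I (nat \<lceil>(1 + \<alpha>) * Th\<rceil>) P y U
         then \<exists>z U. upr_FP_optimal I (nat \<lceil>(1 + \<alpha>) * Th\<rceil>) P z U \<and> UB' = min UB U \<and> res = Some z
         else UB' = UB \<and> res = None"
    using assms(1) unfolding compute_UB_def Let_def by blast
  then consider "UB' = UB" | z U where "upr_FP_optimal I (nat \<lceil>(1 + \<alpha>) * Th\<rceil>) P z U" "UB' = min UB U"
    by (auto split: if_splits)
  then show ?thesis
  proof cases
    case 2
    have "0 \<le> U" using 2(1) FP_feasible_nonneg[OF _ assms(2)] unfolding upr_FP_optimal_def by blast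
    then show ?thesis using 2(2) assms(3) by simp
  qed (use assms(3) in simp)
qed

text \<open>The fixed-path optimum is at most \<open>Th\<close>, so the new upper bound does not
  exceed the new lower bound. Feasibility is assumed for all underlying paths because
  \<open>compute_UB\<close> may choose any of them.\<close>

lemma compute_UB_stops:
  assumes FP: "\<And>P. (\<And>k. k \<in> packets I \<Longrightarrow> underlying_path I T S x k (P k)) \<Longrightarrow>
      \<exists>y. upr_FP_feasible I (nat \<lceil>(1 + \<alpha>) * Th\<rceil>) P y Th"
    and UB: "compute_UB I T S x Th \<alpha> UB UB' res"
    and "k \<in> packets I" "0 \<le> UB" "0 \<le> \<alpha>"
  shows "(UB' - max LB Th) / UB' \<le> \<alpha> \<and> res \<noteq> None"
proof -
  obtain P where P: "\<forall>k\<in>packets I. underlying_path I T S x k (P k)"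
    and res: "if \<exists>y U. upr_FP_feasible I (nat \<lceil>(1 + \<alpha>) * Th\<rceil>) P y U
         then \<exists>z U. upr_FP_optimal I (nat \<lceil>(1 + \<alpha>) * Th\<rceil>) P z U \<and> UB' = min UB U \<and> res = Some z
         else UB' = UB \<and> res = None"
    using UB unfolding compute_UB_def Let_def by blast
  obtain y where y: "upr_FP_feasible I (nat \<lceil>(1 + \<alpha>) * Th\<rceil>) P y Th" using FP P by blast
  then have "\<exists>z U. upr_FP_optimal I (nat \<lceil>(1 + \<alpha>) * Th\<rceil>) P z U \<and> UB' = min UB U \<and> res = Some z"
    using res by (simp only: if_P split: if_splits) blast
  then obtain z U where z: "upr_FP_optimal I (nat \<lceil>(1 + \<alpha>) * Th\<rceil>) P z U" "UB' = min UB U" "res = Some z"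
    by blast
  then have "U \<le> Th" using y unfolding upr_FP_optimal_def by blast
  then have "UB' - max LB Th \<le> 0" using z(2) by linarith
  \<comment> \<open>This includes \<open>UB' = 0\<close>, where the quotient is 0 by
    convention.\<close>
  then have "(UB' - max LB Th) / UB' \<le> 0"
    using compute_UB_nonneg[OF UB assms(3,4)] by (rule divide_nonpos_nonneg)
  then show ?thesis using z(3) assms(5) by simp
qed

section \<open>Routings from walks\<close>

lemma set_moves_of:
  assumes "\<And>e. e \<in> set p \<Longrightarrow> exact_arc I e"
  shows "set (moves_of p) = {((v, w), d) | v w d. (v, w) \<in> arcs I \<and>
           Movement (v, d) (w, d + transit I (v, w)) \<in> set p}"
proof (intro set_eqI iffI)
  fix m assume "m \<in> set (moves_of p)"
  then obtain e where e: "e \<in> set p" "is_movement e" "m = (base_arc e, snd (src e))"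
    unfolding moves_of_def by auto
  obtain v t w t' where "e = Movement (v, t) (w, t')" using e(2) by (cases e) auto
  then show "m \<in> {((v, w), d) | v w d. (v, w) \<in> arcs I \<and>
           Movement (v, d) (w, d + transit I (v, w)) \<in> set p}"
    using assms[OF e(1)] e unfolding base_arc_def by auto
next
  fix m assume "m \<in> {((v, w), d) | v w d. (v, w) \<in> arcs I \<and>
           Movement (v, d) (w, d + transit I (v, w)) \<in> set p}"
  then obtain v w d where "m = ((v, w), d)" "Movement (v, d) (w, d + transit I (v, w)) \<in> set p" by blast
  then show "m \<in> set (moves_of p)" unfolding moves_of_def base_arc_def by force
qed

text \<open>Shared by the solutions of the fixed-path problem and those of
  UPR(\<open>D\<^sub>S\<close>); the storage hypothesis therefore speaks of holdover arcs of any
  length that cover the time \<theta>.\<close>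

lemma exact_walks_feasible:
  assumes walk: "\<And>k. k \<in> packets I \<Longrightarrow> twalk E (origin I k, 0) (p k) (dest I k, T)"
    and exact: "\<And>k e. k \<in> packets I \<Longrightarrow> e \<in> set (p k) \<Longrightarrow> exact_arc I e"
    and fin: "finite (packets I)"
    and cap: "\<And>v w d. (v, w) \<in> arcs I \<Longrightarrow>
      card {k \<in> packets I. Movement (v, d) (w, d + transit I (v, w)) \<in> set (p k)} \<le> capacity I (v, w)"
    and stor: "\<And>v \<theta>. v \<in> nodes I \<Longrightarrow>
      card {k \<in> packets_at I v. \<exists>t t'. Holdover (v, t) (v, t') \<in> set (p k) \<and> t \<le> \<theta> \<and> \<theta> < t'} \<le> storage I v"
  shows "feasible_routing I (\<lambda>k. moves_of (p k))"
proof -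
  have ex: "trajectory I (origin I k) 0 (moves_of (p k)) (dest I k)"
    "waits_at I (origin I k) 0 (moves_of (p k)) y \<theta> \<Longrightarrow>
       \<exists>t t'. Holdover (y, t) (y, t') \<in> set (p k) \<and> t \<le> \<theta> \<and> \<theta> < t'"
    if "k \<in> packets I" for k y \<theta>
    using exact_walk[OF walk[OF that] exact[OF that]] by blast+
  have "card {k \<in> packets I. (a, \<theta>) \<in> set (moves_of (p k))} \<le> capacity I a"
    if a: "a \<in> arcs I" for a \<theta>
  proof -
    obtain v w where a': "a = (v, w)" by fastforce
    have "{k \<in> packets I. (a, \<theta>) \<in> set (moves_of (p k))}
        \<subseteq> {k \<in> packets I. Movement (v, \<theta>) (w, \<theta> + transit I (v, w)) \<in> set (p k)}"
    proof
      fix k assume "k \<in> {k \<in> packets I. (a, \<theta>) \<in> set (moves_of (p k))}"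
      then have k: "k \<in> packets I" "(a, \<theta>) \<in> set (moves_of (p k))" by auto
      then show "k \<in> {k \<in> packets I. Movement (v, \<theta>) (w, \<theta> + transit I (v, w)) \<in> set (p k)}"
        using set_moves_of[OF exact[OF k(1)]] a' by auto
    qed
    then have "card {k \<in> packets I. (a, \<theta>) \<in> set (moves_of (p k))}
        \<le> card {k \<in> packets I. Movement (v, \<theta>) (w, \<theta> + transit I (v, w)) \<in> set (p k)}"
      using fin by (intro card_mono) auto
    then show ?thesis using cap[of v w \<theta>] a a' by simp
  qed
  moreover have "card {k \<in> packets_at I v. waits_at I (origin I k) 0 (moves_of (p k)) v \<theta>} \<le> storage I v"
    if v: "v \<in> nodes I" for v \<theta>
  proof -
    have "{k \<in> packets_at I v. waits_at I (origin I k) 0 (moves_of (p k)) v \<theta>}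
        \<subseteq> {k \<in> packets_at I v. \<exists>t t'. Holdover (v, t) (v, t') \<in> set (p k) \<and> t \<le> \<theta> \<and> \<theta> < t'}"
      using ex(2) unfolding packets_at_def by blast
    then have "card {k \<in> packets_at I v. waits_at I (origin I k) 0 (moves_of (p k)) v \<theta>}
        \<le> card {k \<in> packets_at I v. \<exists>t t'. Holdover (v, t) (v, t') \<in> set (p k) \<and> t \<le> \<theta> \<and> \<theta> < t'}"
      using fin unfolding packets_at_def by (intro card_mono) auto
    then show ?thesis using stor[OF v, of \<theta>] by linarith
  qed
  ultimately show ?thesis unfolding feasible_routing_def using ex(1) by blast
qed

lemma card_ones_le_sum:
  assumes "finite A"
  shows "card {a \<in> A. f a = 1} \<le> (\<Sum>a\<in>A. f a :: nat)"
proof -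
  have "card {a \<in> A. f a = 1} = (\<Sum>a\<in>{a \<in> A. f a = 1}. f a)" by simp
  also have "\<dots> \<le> (\<Sum>a\<in>A. f a)" using assms by (intro sum_mono2) auto
  finally show ?thesis .
qed

text \<open>Time increases along every arc, so the support of \<open>x k\<close> is a single walk
  without extra cycles. Hence the routing can make exactly the selected moves, and the horizon
  bounds its makespan.\<close>

lemma FP_feasible_routing:
  assumes inst: "upr_instance I" and x: "upr_FP_feasible I T' P x U"
  shows "\<exists>R. routing_of I x R \<and> feasible_routing I R \<and> makespan I R \<le> T'"
proof -
  interpret partial_network I T' "full_nodes I T'" by (rule partial_network_full[OF inst])
  let ?E = "full_moves I T' \<union> full_holds I T'"
  have bin: "binary_on ?E (x k)" if "k \<in> packets I" for k
    using x that unfolding upr_FP_feasible_def binary_on_def path_arcs_def by blast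
  have ends: "src ` ?E \<subseteq> full_nodes I T'" "tgt ` ?E \<subseteq> full_nodes I T'"
    unfolding full_moves_def full_holds_def full_nodes_def using instance_facts(4,5) by auto
  have exE: "exact_arc I e" if "e \<in> ?E" for e
    using that unfolding full_moves_def full_holds_def by auto
  have time: "snd (src e) < snd (tgt e)" if "e \<in> ?E" for e
    using that instance_facts(6) unfolding full_moves_def full_holds_def by auto
  have "\<exists>p. twalk {e \<in> ?E. x k e = 1} (origin I k, 0) p (dest I k, T') \<and> {e. x k e = 1} = set p"
    if k: "k \<in> packets I" for k
  proof -
    have flow: "unit_flow (full_nodes I T') ?E (origin I k, 0) (dest I k, T') (x k)"
      using x k unfolding upr_FP_feasible_def by blast
    have "(origin I k, 0) \<in> full_nodes I T'" using instance_facts(7)[OF k] unfolding full_nodes_def by simp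
    then obtain p where "distinct p" "twalk {e \<in> ?E. x k e = 1} (origin I k, 0) p (dest I k, T')"
      using unit_flow_path[OF finite_S finite_full_arcs ends(2) _ flow bin[OF k]] by blast
    then show ?thesis using acyclic_flow_support[OF finite_full_arcs ends(1) flow bin[OF k] time] by blast
  qed
  then have "\<forall>k\<in>packets I. \<exists>p. twalk {e \<in> ?E. x k e = 1} (origin I k, 0) p (dest I k, T') \<and>
      {e. x k e = 1} = set p" by blast
  from bchoice[OF this] obtain p
    where walk: "\<And>k. k \<in> packets I \<Longrightarrow> twalk {e \<in> ?E. x k e = 1} (origin I k, 0) (p k) (dest I k, T')"
      and supp: "\<And>k. k \<in> packets I \<Longrightarrow> {e. x k e = 1} = set (p k)" by blast
  have walkE: "twalk ?E (origin I k, 0) (p k) (dest I k, T')" and subE: "set (p k) \<subseteq> ?E"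
    if "k \<in> packets I" for k
    using twalk_subset[OF walk[OF that]] by (auto intro: twalk_mono[OF walk[OF that]])
  have exact: "exact_arc I e" if "k \<in> packets I" "e \<in> set (p k)" for k e
    using subE[OF that(1)] that(2) exE by blast
  have "feasible_routing I (\<lambda>k. moves_of (p k))"
  proof (rule exact_walks_feasible[OF walkE exact instance_facts(2)])
    fix v w d assume a: "(v, w) \<in> arcs I"
    let ?e = "Movement (v, d) (w, d + transit I (v, w))"
    have eq: "{k \<in> packets I. ?e \<in> set (p k)} = {k \<in> packets I. x k ?e = 1}" using supp by blast
    show "card {k \<in> packets I. ?e \<in> set (p k)} \<le> capacity I (v, w)"
    proof (cases "?e \<in> full_moves I T'")
      case True
      then have "(\<Sum>k\<in>packets I. x k ?e) \<le> capacity I (base_arc ?e)"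
        using x unfolding upr_FP_feasible_def by blast
      then show ?thesis unfolding eq
        using card_ones_le_sum[OF instance_facts(2), of "\<lambda>k. x k ?e"] by (simp add: base_arc_def)
    next
      case False
      then have "?e \<notin> ?E" unfolding full_holds_def by auto
      then have empty: "{k \<in> packets I. ?e \<in> set (p k)} = {}" using subE by blast
      show ?thesis unfolding empty by simp
    qed
  next
    fix v \<theta> assume v: "v \<in> nodes I"
    let ?e = "Holdover (v, \<theta>) (v, \<theta> + 1)"
    let ?A = "{k \<in> packets_at I v. \<exists>t t'. Holdover (v, t) (v, t') \<in> set (p k) \<and> t \<le> \<theta> \<and> \<theta> < t'}"
    have sub: "x k ?e = 1 \<and> ?e \<in> full_holds I T'" if k: "k \<in> ?A" for k
    proof -
      have kp: "k \<in> packets I" using k unfolding packets_at_def by simp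
      obtain t t' where t: "Holdover (v, t) (v, t') \<in> set (p k)" "t \<le> \<theta>" "\<theta> < t'"
        using k by blast
      then have hold: "Holdover (v, t) (v, t') \<in> full_holds I T'"
        using subE[OF kp] unfolding full_moves_def by auto
      then have "t' = t + 1" unfolding full_holds_def by auto
      then have eq: "Holdover (v, t) (v, t') = ?e" using t(2,3) by simp
      have "x k (Holdover (v, t) (v, t')) = 1" using supp[OF kp] t(1) by blast
      then show ?thesis using hold unfolding eq by blast
    qed
    show "card ?A \<le> storage I v"
    proof (cases "?e \<in> full_holds I T'")
      case True
      then have "(\<Sum>k\<in>packets_at I (fst (src ?e)). x k ?e) \<le> storage I (fst (src ?e))"
        using x unfolding upr_FP_feasible_def by blast
      moreover have "card ?A \<le> card {k \<in> packets_at I v. x k ?e = 1}"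
        using instance_facts(3) sub by (intro card_mono) auto
      ultimately show ?thesis
        using card_ones_le_sum[OF instance_facts(3), of v "\<lambda>k. x k ?e"] by simp
    next
      case False
      then have empty: "?A = {}" using sub by blast
      show ?thesis unfolding empty by simp
    qed
  qed
  moreover have "routing_of I x (\<lambda>k. moves_of (p k))"
    unfolding routing_of_def
  proof
    fix k assume k: "k \<in> packets I"
    show "set (moves_of (p k)) = {((v, w), d) | v w d. (v, w) \<in> arcs I \<and>
        x k (Movement (v, d) (w, d + transit I (v, w))) = 1}"
      using set_moves_of[OF exact[OF k]] supp[OF k] by blast
  qed
  moreover have "makespan I (\<lambda>k. moves_of (p k)) \<le> T'"
    unfolding makespan_le_iff[OF instance_facts(2)]
  proof
    fix k assume k: "k \<in> packets I"
    show "arrival_time I 0 (moves_of (p k)) \<le> T'"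
      using exact_walk[OF walkE[OF k] exact[OF k]] by blast
  qed
  ultimately show ?thesis by blast
qed

section \<open>Progress of the augmentation step\<close>

lemma sum_nat_pos: "0 < sum f A \<Longrightarrow> \<exists>a\<in>A. 0 < (f a :: nat)"
  using sum.neutral[of A f] by fastforce

lemma arrival_time_le:
  assumes "\<And>e d. (e, d) \<in> set ms \<Longrightarrow> d + transit I e \<le> c" "a \<le> c"
  shows "arrival_time I a ms \<le> c"
  using assms
proof (induction ms arbitrary: a)
  case (Cons m ms)
  obtain e d where "m = (e, d)" by fastforce
  then show ?case using Cons.IH[of "d + transit I e"] Cons.prems(1) by simp
qed simp

text \<open>For the first iteration: the walk must leave \<open>v\<close> by a movement arc, and
  once at \<open>w\<close> it can never leave, since every movement leads back to
  \<open>w\<close>.\<close>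

lemma twalk_single_head:
  assumes "twalk E (v, a) p (z, b)" "v \<noteq> z"
    and "\<And>e. e \<in> set p \<Longrightarrow> is_movement e \<Longrightarrow> fst (tgt e) = w"
    and "\<And>e. e \<in> set p \<Longrightarrow> \<not> is_movement e \<Longrightarrow> fst (tgt e) = fst (src e)"
  shows "z = w \<and> (\<exists>e\<in>set p. is_movement e \<and> fst (src e) = v)"
  using assms
proof (induction p arbitrary: v a)
  case (Cons e p)
  obtain y c where e: "tgt e = (y, c)" by fastforce
  have walk: "twalk E (y, c) p (z, b)" "src e = (v, a)" using Cons.prems(1) e by auto
  show ?case
  proof (cases "is_movement e")
    case True
    then have "y = w" using Cons.prems(3)[of e] e by simp
    then have "z = w" using Cons.IH[OF walk(1)] Cons.prems(3,4) by fastforce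
    then show ?thesis using True walk(2) by fastforce
  next
    case False
    then have "y = v" using Cons.prems(4)[of e] e walk(2) by simp
    then show ?thesis using Cons.IH[OF walk(1)] Cons.prems(2-4) by fastforce
  qed
qed simp

lemma augment_supset: "S \<subseteq> augment I T S x"
  unfolding augment_def by blast

lemma augment_short_move:
  "Movement (v, t) (w, t') \<in> part_moves I S \<Longrightarrow>
     0 < (\<Sum>k\<in>packets I. x k (Movement (v, t) (w, t'))) \<Longrightarrow>
     t' < t + transit I (v, w) \<Longrightarrow> (w, t + transit I (v, w)) \<in> augment I T S x"
  unfolding augment_def by blast

lemma augment_full_move:
  "Movement (v, t) (w, t') \<in> part_moves I S \<Longrightarrow>
     capacity I (v, w) < (\<Sum>k\<in>packets I. x k (Movement (v, t) (w, t'))) \<Longrightarrow>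
     (v, t + 1) \<in> augment I T S x"
  unfolding augment_def by blast

lemma augment_full_hold:
  assumes "Holdover (v, t) (v, t') \<in> part_holds T S"
    "storage I v < (\<Sum>k\<in>packets_at I v. x k (Holdover (v, t) (v, t')))"
  shows "(v, t + 1) \<in> augment I T S x"
    "(z, r) \<in> move_tails (full_moves I T) (v, t) \<Longrightarrow> 1 < next_gap S (z, r) \<Longrightarrow>
       (z, r + 1) \<in> augment I T S x"
  using assms unfolding augment_def by blast+

section \<open>Range of the nodes added by augmentation\<close>

context partial_network
begin

lemma DS_underlying_path:
  assumes x: "upr_DS_feasible I T S x U" and k: "k \<in> packets I"
  shows "\<exists>P. underlying_path I T S x k P"
proof -
  have "unit_flow S net (origin I k, 0) (dest I k, T) (x k)" "binary_on net (x k)"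
    using x k unfolding upr_DS_feasible_def by blast+
  moreover have "(origin I k, 0) \<in> S" using instance_facts(7)[OF k] lower by auto
  ultimately show ?thesis
    using unit_flow_path[OF finite_S finite_net(3) tgt_net] unfolding underlying_path_def by blast
qed

lemma DS_used_move:
  assumes "upr_DS_feasible I T S x U" "k \<in> packets I" "e \<in> part_moves I S" "0 < x k e"
  shows "real (true_arrival I e) \<le> U"
proof -
  have "real (true_arrival I e * x k e) \<le> U" using assms(1-3) unfolding upr_DS_feasible_def by blast
  moreover have "true_arrival I e \<le> true_arrival I e * x k e" using assms(4) by simp
  ultimately show ?thesis by (meson of_nat_le_iff order_trans)
qed

text \<open>A packet held at a node it neither starts nor ends at leaves that node later.\<close>

lemma DS_used_hold:
  assumes x: "upr_DS_feasible I T S x U" and k: "k \<in> packets_at I v"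
    and e: "Holdover (v, t) (v, t') \<in> part_holds T S" "0 < x k (Holdover (v, t) (v, t'))"
  shows "real t' + 1 \<le> U"
  using e
proof (induction "T - t" arbitrary: t t' rule: less_induct)
  case less
  have kp: "k \<in> packets I" "v \<noteq> origin I k" "v \<noteq> dest I k" using k unfolding packets_at_def by auto
  have vt: "(v, t) \<in> S" "t < T" "t' = next_at v t" using less.prems(1) unfolding part_holds_def by auto
  have v: "v \<in> nodes I" using S_iff_bounds[OF vt(1)] by simp
  note nxt = next_mem[OF v vt(2), folded vt(3)]
  have "unit_flow S net (origin I k, 0) (dest I k, T) (x k)"
    using x kp(1) unfolding upr_DS_feasible_def by blast
  \<comment> \<open>Since \<open>v\<close> is neither origin nor destination, inflow at
    \<open>(v, t')\<close> forces a used outgoing arc: a movement gives the bound, and another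
    holdover arc has a smaller distance to \<open>T\<close>.\<close>
  then have "int (\<Sum>f | f \<in> net \<and> src f = (v, t'). x k f) = int (\<Sum>f | f \<in> net \<and> tgt f = (v, t'). x k f)"
    using nxt(1) kp(2,3) unfolding unit_flow_def by fastforce
  moreover have "x k (Holdover (v, t) (v, t')) \<le> (\<Sum>f | f \<in> net \<and> tgt f = (v, t'). x k f)"
    using less.prems(1) finite_net(3) by (intro member_le_sum) auto
  ultimately have "0 < (\<Sum>f | f \<in> net \<and> src f = (v, t'). x k f)" using less.prems(2) by linarith
  then obtain f where f: "f \<in> net" "src f = (v, t')" "0 < x k f" using sum_nat_pos by blast
  show ?case
  proof (cases "f \<in> part_moves I S")
    case True
    then obtain w where w: "base_arc f = (v, w)" "(v, w) \<in> arcs I"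
      using f(2) unfolding part_moves_def base_arc_def by auto
    then have "real (t' + transit I (v, w)) \<le> U"
      using DS_used_move[OF x kp(1) True f(3)] f(2) unfolding true_arrival_def by simp
    then show ?thesis using instance_facts(6)[OF w(2)] by linarith
  next
    case False
    then have hold: "f \<in> part_holds T S" using f(1) by blast
    then obtain t'' where f': "f = Holdover (v, t') (v, t'')" "t' < T" "t'' = next_at v t'"
      using f(2) unfolding part_holds_def by auto
    then have "real t'' + 1 \<le> U" using less.hyps[of t' t''] hold f(3) nxt(2) by auto
    then show ?thesis using next_mem(2)[OF v f'(2)] f'(3) by linarith
  qed
qed

text \<open>Every new node is traced to a used movement arc whose true arrival is at most
  \<open>U\<close>; for an overfull holdover arc this is the later departure found in
  \<open>DS_used_hold\<close>. The increments by one fit because transit times are positive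
  integers.\<close>

lemma augment_upper:
  assumes x: "upr_DS_feasible I T S x U" and U: "U \<le> real M"
  shows "augment I T S x \<subseteq> S \<union> nodes I \<times> {1..M}"
proof
  fix n assume "n \<in> augment I T S x"
  then consider "n \<in> S"
    | (short) v t w t' where "n = (w, t + transit I (v, w))" "Movement (v, t) (w, t') \<in> part_moves I S"
      "0 < (\<Sum>k\<in>packets I. x k (Movement (v, t) (w, t')))"
    | (over) v t w t' where "n = (v, t + 1)" "Movement (v, t) (w, t') \<in> part_moves I S"
      "capacity I (v, w) < (\<Sum>k\<in>packets I. x k (Movement (v, t) (w, t')))"
    | (tail) z r v t t' where "n = (z, r + 1)" "Holdover (v, t) (v, t') \<in> part_holds T S"
      "storage I v < (\<Sum>k\<in>packets_at I v. x k (Holdover (v, t) (v, t')))"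
      "(z, r) \<in> move_tails (full_moves I T) (v, t)"
    | (hold) v t t' where "n = (v, t + 1)" "Holdover (v, t) (v, t') \<in> part_holds T S"
      "storage I v < (\<Sum>k\<in>packets_at I v. x k (Holdover (v, t) (v, t')))"
    unfolding augment_def by (elim UnE CollectE exE conjE) blast+
  then show "n \<in> S \<union> nodes I \<times> {1..M}"
  proof cases
    case short
    have a: "(v, w) \<in> arcs I" using short(2) unfolding part_moves_def by auto
    obtain k where "k \<in> packets I" "0 < x k (Movement (v, t) (w, t'))" using sum_nat_pos[OF short(3)] by blast
    then have "real (t + transit I (v, w)) \<le> U"
      using DS_used_move[OF x _ short(2)] unfolding true_arrival_def base_arc_def by simp
    then have "t + transit I (v, w) \<le> M" using U by linarith
    then show ?thesis using short(1) instance_facts(5,6)[OF a] by auto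
  next
    case over
    have a: "(v, w) \<in> arcs I" using over(2) unfolding part_moves_def by auto
    obtain k where "k \<in> packets I" "0 < x k (Movement (v, t) (w, t'))" using sum_nat_pos[OF le_less_trans[OF le0 over(3)]] by blast
    then have "real (t + transit I (v, w)) \<le> U"
      using DS_used_move[OF x _ over(2)] unfolding true_arrival_def base_arc_def by simp
    then have "t + transit I (v, w) \<le> M" using U by linarith
    then show ?thesis using over(1) instance_facts(4,6)[OF a] by auto
  next
    case tail
    obtain k where k: "k \<in> packets_at I v" "0 < x k (Holdover (v, t) (v, t'))"
      using sum_nat_pos[OF le_less_trans[OF le0 tail(3)]] by blast
    have "t < t'" using tail(2) next_mem(2) S_iff_bounds unfolding part_holds_def by auto
    then have "t < M" using DS_used_hold[OF x k(1) tail(2) k(2)] U by linarith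
    moreover have "(z, v) \<in> arcs I" "r + transit I (z, v) = t"
      using tail(4) unfolding move_tails_def full_moves_def by auto
    ultimately show ?thesis using tail(1) instance_facts(4,6)[of z v] by auto
  next
    case hold
    obtain k where k: "k \<in> packets_at I v" "0 < x k (Holdover (v, t) (v, t'))"
      using sum_nat_pos[OF le_less_trans[OF le0 hold(3)]] by blast
    have "t < t'" "v \<in> nodes I" using hold(2) next_mem(2) S_iff_bounds unfolding part_holds_def by auto
    then show ?thesis using DS_used_hold[OF x k(1) hold(2) k(2)] U hold(1) by auto
  qed blast
qed

section \<open>Solutions for which augmentation adds no node\<close>

lemma saturated_exact:
  assumes "augment I T S x \<subseteq> S" "k \<in> packets I" "Movement (v, t) (w, t') \<in> part_moves I S"
    "0 < x k (Movement (v, t) (w, t'))"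
  shows "t' = t + transit I (v, w)"
proof (rule ccontr)
  assume neq: "t' \<noteq> t + transit I (v, w)"
  have t': "t' = rd w (t + transit I (v, w))" "(v, w) \<in> arcs I"
    using assms(3) unfolding part_moves_def by auto
  then have "t' < t + transit I (v, w)"
    using rd_mem[of w "t + transit I (v, w)"] instance_facts(5) neq by fastforce
  moreover have "0 < (\<Sum>k\<in>packets I. x k (Movement (v, t) (w, t')))"
    using assms(2,4) member_le_sum[of k "packets I" "\<lambda>k. x k (Movement (v, t) (w, t'))"] instance_facts(2)
    by auto
  ultimately have "(w, t + transit I (v, w)) \<in> S" using augment_short_move[OF assms(3)] assms(1) by blast
  \<comment> \<open>A copy of \<open>w\<close> at the true arrival time would itself have been the
    rounding target.\<close>
  then show False using rd_exact t'(1) neq by metis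
qed

text \<open>Overfullness would put \<open>(v, t + 1)\<close> into \<open>S\<close>; the gap is then
  1 and the relaxed capacity is the original one.\<close>

lemma saturated_move:
  assumes "upr_DS_feasible I T S x U" "augment I T S x \<subseteq> S" "Movement (v, t) (w, t') \<in> part_moves I S"
  shows "(\<Sum>k\<in>packets I. x k (Movement (v, t) (w, t'))) \<le> capacity I (v, w)"
proof (rule ccontr)
  assume over: "\<not> ?thesis"
  then have "(v, t + 1) \<in> S" using augment_full_move[OF assms(3)] assms(2) by fastforce
  then have "part_move_cap I S (Movement (v, t) (w, t')) = capacity I (v, w)"
    using next_Suc unfolding part_move_cap_def next_gap_def base_arc_def by simp
  then show False using assms(1,3) over unfolding upr_DS_feasible_def by fastforce
qed

text \<open>If the arc were overfull, all nodes requested by augmentation would be present. Then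
  every factor of the slack vanishes and the relaxed capacity shrinks to
  \<open>storage I v\<close>.\<close>

lemma saturated_hold:
  assumes x: "upr_DS_feasible I T S x U" and sat: "augment I T S x \<subseteq> S"
    and e: "Holdover (v, t) (v, t') \<in> part_holds T S"
  shows "(\<Sum>k\<in>packets_at I v. x k (Holdover (v, t) (v, t'))) \<le> storage I v"
proof (rule ccontr)
  assume "\<not> ?thesis"
  then have over: "storage I v < (\<Sum>k\<in>packets_at I v. x k (Holdover (v, t) (v, t')))" by simp
  have vt: "(v, t) \<in> S" "t < T" using e unfolding part_holds_def by auto
  have Suc: "(v, t + 1) \<in> S" using augment_full_hold(1)[where I = I and x = x, OF e over] sat by blast
  have gap: "next_gap S (z, r) - 1 = 0" if z: "(z, r) \<in> move_tails (full_moves I T) (v, t)" for z r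
  proof (rule ccontr)
    assume "next_gap S (z, r) - 1 \<noteq> 0"
    then have gt: "1 < next_gap S (z, r)" by simp
    then have "(z, r + 1) \<in> S" using augment_full_hold(2)[where I = I and x = x, OF e over z gt] sat by blast
    then show False using next_Suc[of z r] gt unfolding next_gap_def by simp
  qed
  \<comment> \<open>Augmentation refines only tails in the full network. Since
    \<open>(v, t + 1)\<close> is present, an arrival rounded to \<open>t\<close> is exactly
    \<open>t\<close>, so the tails in \<open>D\<^sub>S\<close> are among them.\<close>
  have "move_tails (part_moves I S) (v, t) \<subseteq> move_tails (full_moves I T) (v, t)"
  proof
    fix n assume "n \<in> move_tails (part_moves I S) (v, t)"
    then obtain z r where n: "n = (z, r)" "(z, v) \<in> arcs I" "rd v (r + transit I (z, v)) = t"
      unfolding move_tails_def part_moves_def by auto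
    have "t \<le> r + transit I (z, v)" using rd_mem[of v "r + transit I (z, v)"] n instance_facts(5)[OF n(2)] by auto
    moreover have "r + transit I (z, v) < t + 1"
      using rd_ge[OF Suc, of "r + transit I (z, v)"] n(3) by linarith
    ultimately show "n \<in> move_tails (full_moves I T) (v, t)"
      using move_tails_full[OF n(2), of r t T] vt(2) n(1) by simp
  qed
  then have "part_hold_slack I T S (v, t) = 0"
    unfolding part_hold_slack_def using gap by (intro sum.neutral) auto
  then have "part_hold_cap I T S (v, t) = storage I v" using Suc unfolding part_hold_cap_def by simp
  then show False using x e over unfolding upr_DS_feasible_def by fastforce
qed

text \<open>Used arcs have true transit times and respect the original capacities, so the walks
  behind any admissible \<open>P\<close> form a feasible routing along these very paths.\<close>

lemma saturated_FP_feasible: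
  assumes x: "upr_DS_feasible I T S x U" and sat: "augment I T S x \<subseteq> S"
    and P: "\<And>k. k \<in> packets I \<Longrightarrow> underlying_path I T S x k (P k)"
    and U: "0 \<le> U" "U \<le> real T'"
  shows "\<exists>y. upr_FP_feasible I T' P y U"
proof -
  have "\<forall>k\<in>packets I. \<exists>p. twalk {e \<in> net. x k e = 1} (origin I k, 0) p (dest I k, T) \<and>
      P k = map base_arc (filter is_movement p)"
    using P unfolding underlying_path_def by blast
  from bchoice[OF this] obtain p
    where walk: "\<And>k. k \<in> packets I \<Longrightarrow> twalk {e \<in> net. x k e = 1} (origin I k, 0) (p k) (dest I k, T)"
      and Pp: "\<And>k. k \<in> packets I \<Longrightarrow> P k = map base_arc (filter is_movement (p k))" by blast
  have sub: "set (p k) \<subseteq> {e \<in> net. x k e = 1}" if "k \<in> packets I" for k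
    using walk[OF that] by (rule twalk_subset)
  have walkN: "twalk net (origin I k, 0) (p k) (dest I k, T)" if "k \<in> packets I" for k
    using walk[OF that] by (rule twalk_mono) (use sub[OF that] in blast)
  have exact: "exact_arc I e" if k: "k \<in> packets I" and e: "e \<in> set (p k)" for k e
  proof (cases "e \<in> part_moves I S")
    case True
    then obtain v t w t' where e': "e = Movement (v, t) (w, t')" "(v, w) \<in> arcs I"
      unfolding part_moves_def by auto
    have "0 < x k e" using sub[OF k] e by auto
    then show ?thesis using saturated_exact[OF sat k, of v t w t'] True e' by simp
  next
    case False
    then have "e \<in> part_holds T S" using sub[OF k] e by blast
    then obtain v t where e': "e = Holdover (v, t) (v, next_at v t)" "(v, t) \<in> S" "t < T"
      unfolding part_holds_def by auto
    then show ?thesis using next_mem(2)[of v t] S_iff_bounds[OF e'(2)] by simp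
  qed
  have "feasible_routing I (\<lambda>k. moves_of (p k))"
  proof (rule exact_walks_feasible[OF walkN exact instance_facts(2)])
    fix v w d assume "(v, w) \<in> arcs I"
    let ?e = "Movement (v, d) (w, d + transit I (v, w))"
    show "card {k \<in> packets I. ?e \<in> set (p k)} \<le> capacity I (v, w)"
    proof (cases "?e \<in> part_moves I S")
      case True
      have "card {k \<in> packets I. ?e \<in> set (p k)} \<le> card {k \<in> packets I. x k ?e = 1}"
        using instance_facts(2) sub by (intro card_mono) auto
      then show ?thesis
        using card_ones_le_sum[OF instance_facts(2), of "\<lambda>k. x k ?e"] saturated_move[OF x sat True] by linarith
    next
      case False
      then have empty: "{k \<in> packets I. ?e \<in> set (p k)} = {}"
        using sub unfolding part_holds_def by blast
      show ?thesis unfolding empty by simp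
    qed
  next
    fix v \<theta> assume v: "v \<in> nodes I"
    \<comment> \<open>The only holdover arc at \<open>v\<close> that covers \<theta>, so a single
      arc capacity controls the storage at that time.\<close>
    let ?e = "Holdover (v, rd v \<theta>) (v, next_at v (rd v \<theta>))"
    let ?A = "{k \<in> packets_at I v. \<exists>t t'. Holdover (v, t) (v, t') \<in> set (p k) \<and> t \<le> \<theta> \<and> \<theta> < t'}"
    have hold: "x k ?e = 1 \<and> ?e \<in> part_holds T S" if k: "k \<in> ?A" for k
    proof -
      have kp: "k \<in> packets I" using k unfolding packets_at_def by simp
      obtain t t' where t: "Holdover (v, t) (v, t') \<in> set (p k)" "t \<le> \<theta>" "\<theta> < t'"
        using k by blast
      then have h: "Holdover (v, t) (v, t') \<in> part_holds T S" "x k (Holdover (v, t) (v, t')) = 1"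
        using sub[OF kp] unfolding part_moves_def by auto
      then have t': "(v, t) \<in> S" "t' = next_at v t" unfolding part_holds_def by auto
      have "t = rd v \<theta>"
      proof (rule ccontr)
        assume "t \<noteq> rd v \<theta>"
        then have "t' \<le> rd v \<theta>"
          using rd_ge[OF t'(1) t(2)] next_le[of v "rd v \<theta>" t] rd_mem[OF v, of \<theta>] t'(2) by linarith
        then show False using rd_mem[OF v, of \<theta>] t(3) by linarith
      qed
      then show ?thesis using h t'(2) by simp
    qed
    show "card ?A \<le> storage I v"
    proof (cases "?e \<in> part_holds T S")
      case True
      have "card ?A \<le> card {k \<in> packets_at I v. x k ?e = 1}"
        using instance_facts(3) hold by (intro card_mono) auto
      then show ?thesis
        using card_ones_le_sum[OF instance_facts(3), of v "\<lambda>k. x k ?e"] saturated_hold[OF x sat True] by linarith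
    next
      case False
      then have empty: "?A = {}" using hold by blast
      show ?thesis unfolding empty by simp
    qed
  qed
  moreover have "fst ` set (moves_of (p k)) \<subseteq> set (P k)" if "k \<in> packets I" for k
    unfolding moves_of_def Pp[OF that] by auto
  moreover have "real (arrival_time I 0 (moves_of (p k))) \<le> U" if k: "k \<in> packets I" for k
  proof -
    have "d + transit I a \<le> nat \<lfloor>U\<rfloor>" if "(a, d) \<in> set (moves_of (p k))" for a d
    proof -
      obtain e where e: "e \<in> set (p k)" "is_movement e" "a = base_arc e" "d = snd (src e)"
        using \<open>(a, d) \<in> set (moves_of (p k))\<close> unfolding moves_of_def by auto
      then have "e \<in> part_moves I S" "0 < x k e" using sub[OF k] is_movement_part(2) by auto
      then have "real (d + transit I a) \<le> U"
        using DS_used_move[OF x k] e unfolding true_arrival_def by simp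
      then show ?thesis by (rule le_nat_floor)
    qed
    then have "arrival_time I 0 (moves_of (p k)) \<le> nat \<lfloor>U\<rfloor>" by (rule arrival_time_le[OF _ le0])
    then show ?thesis using U(1) by linarith
  qed
  ultimately show ?thesis using routing_FP_feasible[OF inst] U by blast
qed

text \<open>
  In the coarsest network every used arc \<open>vw\<close> is rounded down, so the single new node must be
  \<open>(w, \<tau>)\<close> for all of them; then every packet just crosses one arc at time \<open>0\<close>, and an overfull
  arc would have added a second node \<open>(v, 1)\<close>.
\<close>

lemma first_iteration_FP_feasible:
  assumes x: "upr_DS_feasible I T S x U" and S: "S = nodes I \<times> {0, T}"
    and new: "augment I T S x - S \<subseteq> {(w\<^sub>0, \<tau>\<^sub>0)}"
    and P: "\<And>k. k \<in> packets I \<Longrightarrow> underlying_path I T S x k (P k)"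
    and U: "0 \<le> U" "U < real T" "U \<le> real T'"
  shows "\<exists>y. upr_FP_feasible I T' P y U"
proof -
  have used: "\<exists>v. e = Movement (v, 0) (w\<^sub>0, 0) \<and> (v, w\<^sub>0) \<in> arcs I \<and> transit I (v, w\<^sub>0) = \<tau>\<^sub>0 \<and>
      real \<tau>\<^sub>0 \<le> U \<and> 1 < T"
    if k: "k \<in> packets I" and e: "e \<in> part_moves I S" "0 < x k e" for k e
  proof -
    obtain v t w where e': "e = Movement (v, t) (w, rd w (t + transit I (v, w)))" "(v, t) \<in> S" "(v, w) \<in> arcs I"
      using e(1) unfolding part_moves_def by auto
    let ?\<tau> = "transit I (v, w)"
    have arr: "real (t + ?\<tau>) \<le> U" using DS_used_move[OF x k e] e'(1) unfolding true_arrival_def base_arc_def by simp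
    \<comment> \<open>The only other copy is at \<open>T\<close>, and a departure there would cost
      more than \<open>U\<close>.\<close>
    then have t: "t = 0" using e'(2) S U(2) by auto
    have \<tau>: "0 < ?\<tau>" "?\<tau> < T" "real ?\<tau> \<le> U" using instance_facts(6)[OF e'(3)] arr U(2) t by auto
    have "(w, rd w ?\<tau>) \<in> S" "rd w ?\<tau> \<le> ?\<tau>" using rd_mem instance_facts(5)[OF e'(3)] by auto
    then have rd: "rd w ?\<tau> = 0" using S \<tau>(2) by auto
    have "0 < (\<Sum>k\<in>packets I. x k e)"
      using k e(2) member_le_sum[of k "packets I" "\<lambda>k. x k e"] instance_facts(2) by auto
    then have "(w, ?\<tau>) \<in> augment I T S x"
      using augment_short_move[of v 0 w 0 I S x T] e(1) e'(1) t rd \<tau>(1) by simp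
    moreover have "(w, ?\<tau>) \<notin> S" using S \<tau> by auto
    ultimately have "w = w\<^sub>0" "?\<tau> = \<tau>\<^sub>0" using new by auto
    then show ?thesis using e' t rd \<tau> by auto
  qed
  \<comment> \<open>All waiting before and after the crossing is dropped, so no storage is
    used.\<close>
  define R :: "'k \<Rightarrow> 'v move list" where "R k = (if origin I k = dest I k then [] else [((origin I k, w\<^sub>0), 0)])" for k
  have cross: "dest I k = w\<^sub>0 \<and> x k (Movement (origin I k, 0) (w\<^sub>0, 0)) = 1 \<and>
      Movement (origin I k, 0) (w\<^sub>0, 0) \<in> part_moves I S \<and> (origin I k, w\<^sub>0) \<in> set (P k)"
    if k: "k \<in> packets I" and neq: "origin I k \<noteq> dest I k" for k
  proof -
    obtain p where p: "twalk {e \<in> net. x k e = 1} (origin I k, 0) p (dest I k, T)"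
      "P k = map base_arc (filter is_movement p)" using P[OF k] unfolding underlying_path_def by blast
    have sub: "set p \<subseteq> {e \<in> net. x k e = 1}" using p(1) by (rule twalk_subset)
    have mov: "e \<in> part_moves I S \<and> 0 < x k e" if "e \<in> set p" "is_movement e" for e
      using sub that is_movement_part(2) by auto
    have "fst (tgt e) = w\<^sub>0" if "e \<in> set p" "is_movement e" for e
      using used[OF k, of e] mov[OF that] by auto
    moreover have "fst (tgt e) = fst (src e)" if "e \<in> set p" "\<not> is_movement e" for e
    proof -
      have "e \<in> part_holds T S" using sub that is_movement_part(1) by blast
      then show ?thesis unfolding part_holds_def by auto
    qed
    ultimately obtain e where e: "dest I k = w\<^sub>0" "e \<in> set p" "is_movement e" "fst (src e) = origin I k"
      using twalk_single_head[OF p(1) neq] by blast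
    then have eq: "e = Movement (origin I k, 0) (w\<^sub>0, 0)" using used[OF k, of e] mov[OF e(2,3)] by auto
    have "base_arc e \<in> set (P k)" using e(2,3) p(2) by auto
    then have "(origin I k, w\<^sub>0) \<in> set (P k)" unfolding eq base_arc_def by simp
    moreover have "x k e = 1" using sub e(2) by blast
    ultimately show ?thesis using e(1) mov[OF e(2,3)] unfolding eq by blast
  qed
  have arc: "(origin I k, w\<^sub>0) \<in> arcs I \<and> transit I (origin I k, w\<^sub>0) = \<tau>\<^sub>0 \<and> real \<tau>\<^sub>0 \<le> U \<and> 1 < T"
    if "k \<in> packets I" "origin I k \<noteq> dest I k" for k
    using used[OF that(1), of "Movement (origin I k, 0) (w\<^sub>0, 0)"] cross[OF that] by auto
  have cap: "card {k \<in> packets I. (a, \<theta>) \<in> set (R k)} \<le> capacity I a" for a \<theta>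
  proof (cases "{k \<in> packets I. (a, \<theta>) \<in> set (R k)} = {}")
    case True
    show ?thesis unfolding True by simp
  next
    case False
    then obtain k0 where k0: "k0 \<in> packets I" "(a, \<theta>) \<in> set (R k0)" by blast
    then have neq: "origin I k0 \<noteq> dest I k0" and a: "a = (origin I k0, w\<^sub>0)"
      unfolding R_def by (auto split: if_splits)
    define v where "v = origin I k0"
    let ?e = "Movement (v, 0) (w\<^sub>0, 0)"
    \<comment> \<open>The node \<open>v\<close> is the origin and \<open>w\<^sub>0\<close> the
      destination of \<open>k0\<close>, so \<open>(v, 1)\<close> cannot be the one permitted new
      node.\<close>
    have "v \<noteq> w\<^sub>0" and e: "?e \<in> part_moves I S" using cross[OF k0(1) neq] neq unfolding v_def by auto
    have "(\<Sum>k\<in>packets I. x k ?e) \<le> capacity I (v, w\<^sub>0)"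
    proof (rule ccontr)
      assume "\<not> ?thesis"
      then have "(v, 1) \<in> augment I T S x" using augment_full_move[OF e, of x T] by simp
      moreover have "(v, 1) \<notin> S" using S arc[OF k0(1) neq] by auto
      ultimately show False using new \<open>v \<noteq> w\<^sub>0\<close> by auto
    qed
    moreover have "card {k \<in> packets I. (a, \<theta>) \<in> set (R k)} \<le> card {k \<in> packets I. x k ?e = 1}"
    proof (intro card_mono)
      show "{k \<in> packets I. (a, \<theta>) \<in> set (R k)} \<subseteq> {k \<in> packets I. x k ?e = 1}"
      proof
        fix k assume "k \<in> {k \<in> packets I. (a, \<theta>) \<in> set (R k)}"
        then have k: "k \<in> packets I" "origin I k \<noteq> dest I k" "origin I k = v"
          using a unfolding R_def v_def by (auto split: if_splits)
        then show "k \<in> {k \<in> packets I. x k ?e = 1}" using cross[OF k(1,2)] by simp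
      qed
    qed (use instance_facts(2) in simp)
    ultimately show ?thesis
      using card_ones_le_sum[OF instance_facts(2), of "\<lambda>k. x k ?e"] unfolding a v_def by linarith
  qed
  have "feasible_routing I R"
    unfolding feasible_routing_def
  proof (intro conjI ballI allI)
    fix k assume k: "k \<in> packets I"
    show "trajectory I (origin I k) 0 (R k) (dest I k)"
      using cross[OF k] arc[OF k] unfolding R_def by auto
  next
    fix v \<theta>
    have empty: "{k \<in> packets_at I v. waits_at I (origin I k) 0 (R k) v \<theta>} = {}"
      unfolding R_def by auto
    show "card {k \<in> packets_at I v. waits_at I (origin I k) 0 (R k) v \<theta>} \<le> storage I v"
      unfolding empty by simp
  qed (rule cap)
  moreover have "fst ` set (R k) \<subseteq> set (P k)" if "k \<in> packets I" for k
    using cross[OF that] unfolding R_def by auto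
  moreover have "real (arrival_time I 0 (R k)) \<le> U" if "k \<in> packets I" for k
    using arc[OF that] U(1) unfolding R_def by auto
  ultimately show ?thesis using routing_FP_feasible[OF inst] U(1,3) by blast
qed

end

section \<open>Termination and correctness\<close>

text \<open>Otherwise the routing without moves has makespan 0. The packet found here makes both
  integer programs bounded below.\<close>

lemma min_makespan_pos:
  assumes "upr_instance I" "is_min_makespan I M" "0 < M"
  shows "\<exists>k\<in>packets I. origin I k \<noteq> dest I k"
proof (rule ccontr)
  assume "\<not> ?thesis"
  then have eq: "\<And>k. k \<in> packets I \<Longrightarrow> origin I k = dest I k" by blast
  have "feasible_routing I (\<lambda>_. [])" unfolding feasible_routing_def using eq by simp
  moreover have "makespan I (\<lambda>_. []) \<le> 0"
    using assms(1) makespan_le_iff[of I "\<lambda>_. []" 0] unfolding upr_instance_def by simp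
  ultimately show False using assms(2,3) unfolding is_min_makespan_def by fastforce
qed

locale ddd_run =
  fixes I :: "('v, 'k) upr" and T M :: nat and \<alpha> :: real
  assumes inst: "upr_instance I" and min: "is_min_makespan I M" and M: "0 < M" "M \<le> T"
    and alpha: "0 \<le> \<alpha>"
begin

text \<open>The extra 1 is the head start behind the strict bound. It may not be visible at
  \<open>n = 0\<close>, where no counted node need exist yet, so the initial network is recorded
  exactly instead.\<close>

fun state_inv :: "nat \<Rightarrow> 'v state \<Rightarrow> bool" where
  "state_inv n (S, UB, LB) \<longleftrightarrow>
     nodes I \<times> {0, T} \<subseteq> S \<and> S \<subseteq> full_nodes I T \<and> 0 \<le> UB \<and>
     (if n = 0 then S = nodes I \<times> {0, T} else n + 1 \<le> card (S \<inter> nodes I \<times> {1..M}))"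

lemma state_inv_network: "state_inv n (S, UB, LB) \<Longrightarrow> partial_network I T S"
  using inst by unfold_locales auto

lemma some_packet: "\<exists>k. k \<in> packets I"
  using min_makespan_pos[OF inst min M(1)] by blast

lemma DS_feasible_min:
  assumes "partial_network I T S"
  shows "\<exists>x. upr_DS_feasible I T S x (real M)"
proof -
  obtain R where "feasible_routing I R" "makespan I R = M"
    using min unfolding is_min_makespan_def by blast
  then show ?thesis using partial_network.relaxation[OF assms] M(2) by blast
qed

lemma DS_optimal_le:
  assumes "partial_network I T S" "upr_DS_optimal I T S x Th"
  shows "upr_DS_feasible I T S x Th" "0 \<le> Th" "Th \<le> real M"
proof -
  show x: "upr_DS_feasible I T S x Th" using assms(2) unfolding upr_DS_optimal_def by blast
  show "0 \<le> Th" using DS_feasible_nonneg[OF x] some_packet by blast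
  show "Th \<le> real M" using assms(2) DS_feasible_min[OF assms(1)] unfolding upr_DS_optimal_def by blast
qed

lemma horizon_ge: "0 \<le> Th \<Longrightarrow> Th \<le> real (nat \<lceil>(1 + \<alpha>) * Th\<rceil>)"
proof -
  assume "0 \<le> Th"
  then have "Th \<le> (1 + \<alpha>) * Th" using alpha by (simp add: algebra_simps)
  then show ?thesis using real_nat_ceiling_ge[of "(1 + \<alpha>) * Th"] by linarith
qed

lemma state_inv_step:
  assumes inv: "state_inv n \<sigma>" and step: "ddd_iteration I T \<alpha> \<sigma> (Continue \<sigma>')"
  shows "state_inv (Suc n) \<sigma>'"
  using step
proof cases
  case (continue S xh Th LB' LB UB UB' res)
  note inv = inv[unfolded continue(1)]
  interpret partial_network I T S using state_inv_network[OF inv] .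
  let ?S' = "augment I T S xh" and ?X = "nodes I \<times> {1..M}"
  obtain k where k: "k \<in> packets I" using some_packet by blast
  have UB: "0 \<le> UB" using inv by simp
  note x = DS_optimal_le[OF partial_network_axioms continue(3)]
  \<comment> \<open>An iteration that continues refutes feasibility of the fixed-path problem at
    value \<open>Th\<close> for some choice of paths. Both the existence of a new node and, in the
    first iteration, of a second one follow by contradiction with this.\<close>
  have nonstop: "\<not> (\<forall>P. (\<forall>k\<in>packets I. underlying_path I T S xh k (P k)) \<longrightarrow>
      (\<exists>y. upr_FP_feasible I (nat \<lceil>(1 + \<alpha>) * Th\<rceil>) P y Th))"
  proof
    assume "\<forall>P. (\<forall>k\<in>packets I. underlying_path I T S xh k (P k)) \<longrightarrow>
      (\<exists>y. upr_FP_feasible I (nat \<lceil>(1 + \<alpha>) * Th\<rceil>) P y Th)"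
    then have "(UB' - max LB Th) / UB' \<le> \<alpha> \<and> res \<noteq> None"
      by (intro compute_UB_stops[OF _ continue(5) k UB alpha]) blast
    then show False using continue(4,6) by simp
  qed
  have S': "S \<subseteq> ?S'" "?S' \<subseteq> S \<union> ?X" by (rule augment_supset) (rule augment_upper[OF x(1,3)])
  have not_sat: "\<not> ?S' \<subseteq> S"
    using nonstop saturated_FP_feasible[OF x(1) _ _ x(2) horizon_ge[OF x(2)]] by blast
  have finX: "finite (?S' \<inter> ?X)" using instance_facts(1) by auto
  have "S \<inter> ?X \<subset> ?S' \<inter> ?X" using S' not_sat by blast
  then have more: "card (S \<inter> ?X) < card (?S' \<inter> ?X)" using finX by (rule psubset_card_mono[rotated])
  have "n + 2 \<le> card (?S' \<inter> ?X)"
  proof (cases "n = 0")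
    case False
    then show ?thesis using inv more by simp
  next
    case True
    then have S: "S = nodes I \<times> {0, T}" using inv by simp
    show ?thesis
    proof (cases "M = T")
      case True
      have "(origin I k, T) \<in> S \<inter> ?X" using S True M instance_facts(7)[OF k] by auto
      then have "S \<inter> ?X \<noteq> {}" by blast
      moreover have "finite (S \<inter> ?X)" using finite_S by simp
      ultimately have "0 < card (S \<inter> ?X)" by (simp only: card_gt_0_iff) blast
      then show ?thesis using more \<open>n = 0\<close> by linarith
    next
      case False
      then have Th: "Th < real T" using x(3) M(2) by simp
      show ?thesis
      proof (rule ccontr)
        assume "\<not> ?thesis"
        moreover have "?S' - S \<subseteq> ?S' \<inter> ?X" using S' by blast
        ultimately have "card (?S' - S) \<le> 1" using card_mono[OF finX, of "?S' - S"] \<open>n = 0\<close> by linarith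
        moreover have "finite (?S' - S)" using finX \<open>?S' - S \<subseteq> ?S' \<inter> ?X\<close> by (rule finite_subset[rotated])
        ultimately obtain m where "?S' - S \<subseteq> {m}"
          by (metis One_nat_def card_le_Suc0_iff_eq insertCI subsetI)
        then obtain w0 t0 where "?S' - S \<subseteq> {(w0, t0)}" by (cases m) blast
        then show False
          using nonstop first_iteration_FP_feasible[OF x(1) S _ _ x(2) Th horizon_ge[OF x(2)]] by blast
      qed
    qed
  qed
  moreover have "nodes I \<times> {0, T} \<subseteq> ?S'" using lower S'(1) by blast
  moreover have "?S' \<subseteq> full_nodes I T" using S'(2) upper M(2) unfolding full_nodes_def by fastforce
  moreover have "0 \<le> UB'" by (rule compute_UB_nonneg[OF continue(5) k UB])
  ultimately show ?thesis unfolding continue(2) by simp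
qed

lemma reaches_inv: "ddd_reaches I T \<alpha> n \<sigma> \<Longrightarrow> state_inv n \<sigma>"
proof (induction rule: ddd_reaches.induct)
  case init
  then show ?case by (auto simp: full_nodes_def)
next
  case (step n \<sigma> \<sigma>')
  then show ?case by (blast intro: state_inv_step)
qed

lemma iterations_less:
  assumes "state_inv n \<sigma>"
  shows "n < card (nodes I) * M"
proof -
  obtain S UB LB where \<sigma>: "\<sigma> = (S, UB, LB)" by (cases \<sigma>) auto
  interpret partial_network I T S using state_inv_network assms unfolding \<sigma> .
  show ?thesis
  proof (cases "n = 0")
    case True
    have "nodes I \<noteq> {}" using some_packet instance_facts(7) by blast
    then show ?thesis using True M(1) instance_facts(1) by (simp add: card_gt_0_iff)
  next
    case False
    then have "n + 1 \<le> card (S \<inter> nodes I \<times> {1..M})" using assms \<sigma> by simp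
    also have "\<dots> \<le> card (nodes I \<times> {1..M})" using instance_facts(1) by (intro card_mono) auto
    also have "\<dots> = card (nodes I) * M" by (simp add: card_cartesian_product)
    finally show ?thesis by simp
  qed
qed

text \<open>Rules out that a run ends by getting stuck; with the iteration bound, every run must
  reach a \<open>Return\<close>.\<close>

lemma iteration_exists:
  assumes "state_inv n \<sigma>"
  shows "\<exists>out. ddd_iteration I T \<alpha> \<sigma> out"
proof -
  obtain S UB LB where \<sigma>: "\<sigma> = (S, UB, LB)" by (cases \<sigma>) auto
  interpret partial_network I T S using state_inv_network assms unfolding \<sigma> .
  obtain k where k: "k \<in> packets I" using some_packet by blast
  obtain y where y: "upr_DS_feasible I T S y (real M)"
    using DS_feasible_min[OF partial_network_axioms] by blast
  obtain x Th where x: "upr_DS_optimal I T S x Th" using DS_optimal_exists[OF y k] by blast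
  have "\<exists>P. underlying_path I T S x k P" if "k \<in> packets I" for k
    using DS_underlying_path[OF DS_optimal_le(1)[OF partial_network_axioms x] that] .
  then obtain UB' res where UB: "compute_UB I T S x Th \<alpha> UB UB' res"
    using compute_UB_exists[OF _ k] by blast
  show ?thesis
  proof (cases "(UB' - max LB Th) / UB' \<le> \<alpha> \<and> res \<noteq> None")
    case True
    then obtain z where z: "res = Some z" by blast
    show ?thesis unfolding \<sigma>
      using ddd_iteration.stop[OF x refl UB[unfolded z] conjunct1[OF True]] by blast
  next
    case False
    show ?thesis unfolding \<sigma> using ddd_iteration.continue[OF x refl UB False] by blast
  qed
qed

text \<open>The returned \<open>y\<close> solves the current fixed-path problem even if
  \<open>UB\<close> was attained in an earlier iteration. Its horizon is monotone in
  \<open>Th\<close>, which is at most the minimum makespan.\<close>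

lemma iteration_return:
  assumes inv: "state_inv n \<sigma>" and step: "ddd_iteration I T \<alpha> \<sigma> (Return y UB)"
  shows "\<exists>R. routing_of I y R \<and> feasible_routing I R \<and>
           real (makespan I R) \<le> of_int \<lceil>(1 + \<alpha>) * real M\<rceil>"
  using step
proof cases
  case (stop S xh Th LB' LB UB\<^sub>0)
  have net: "partial_network I T S" using state_inv_network inv unfolding stop(1) .
  note x = DS_optimal_le[OF net stop(2)]
  let ?T' = "nat \<lceil>(1 + \<alpha>) * Th\<rceil>"
  obtain P where "if \<exists>y U. upr_FP_feasible I ?T' P y U
         then \<exists>z U. upr_FP_optimal I ?T' P z U \<and> UB = min UB\<^sub>0 U \<and> Some y = Some z
         else UB = UB\<^sub>0 \<and> Some y = None"
    using stop(4) unfolding compute_UB_def Let_def by blast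
  then obtain U where "upr_FP_feasible I ?T' P y U"
    unfolding upr_FP_optimal_def by (auto split: if_splits)
  then obtain R where R: "routing_of I y R" "feasible_routing I R" "makespan I R \<le> ?T'"
    using FP_feasible_routing[OF inst] by blast
  have "(1 + \<alpha>) * Th \<le> (1 + \<alpha>) * real M" using x(3) alpha by (intro mult_left_mono) auto
  then have "\<lceil>(1 + \<alpha>) * Th\<rceil> \<le> \<lceil>(1 + \<alpha>) * real M\<rceil>" by (rule ceiling_mono)
  moreover have "0 \<le> \<lceil>(1 + \<alpha>) * Th\<rceil>" using mult_nonneg_nonneg[of "1 + \<alpha>" Th] x(2) alpha by linarith
  ultimately have "int (makespan I R) \<le> \<lceil>(1 + \<alpha>) * real M\<rceil>" using R(3) by linarith
  then have "real (makespan I R) \<le> of_int \<lceil>(1 + \<alpha>) * real M\<rceil>" by linarith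
  then show ?thesis using R(1,2) by blast
qed

end

theorem theorem2:
  fixes I :: "('v, 'k) upr" and T Tstar :: nat and \<alpha> :: real
  assumes "upr_instance I"
    and "is_min_makespan I Tstar"
    and "0 < Tstar"
    and "Tstar \<le> T"
    and "0 \<le> \<alpha>"
  shows "\<forall>n \<sigma>. ddd_reaches I T \<alpha> n \<sigma> \<longrightarrow>
           n < card (nodes I) * Tstar \<and>
           (\<exists>out. ddd_iteration I T \<alpha> \<sigma> out) \<and>
           (\<forall>x UB. ddd_iteration I T \<alpha> \<sigma> (Return x UB) \<longrightarrow>
              (\<exists>R. routing_of I x R \<and> feasible_routing I R \<and>
                   real (makespan I R) \<le> of_int \<lceil>(1 + \<alpha>) * real Tstar\<rceil>))"
proof -
  interpret ddd_run I T Tstar \<alpha> using assms by unfold_locales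
  show ?thesis using reaches_inv iterations_less iteration_exists iteration_return by blast
qed

end
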